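(* Let $G=(V,A)$ be a directed uncapacitated network with sinks $t_1,\dots,t_k$ and exactly $\kappa$ non-zero supplies, all of which are equal. Suppose $f$ is a (splittable) $1$-satisfiable static flow. Then there is a randomized algorithm that finds a multi-sink confluent flow $f'$ whose node congestion is $O((NC(f))^2\log^3\kappa)$ with high probability.
   Context: Each node $v$ of $G$ carries a supply $d(v)\ge 0$. In an uncapacitated network, every edge capacity and every node capacity equals $1$. A static flow $f$ is $\beta$-satisfiable if at least a $\beta$ fraction of every supply is sent to the sinks. A flow is confluent if every non-sink node sends all of its outgoing flow along a single edge. The node congestion of $v$ is $NC(v)=f^{out}(v)/c(v)$, where $f^{out}(v)$ is the total flow leaving $v$. The node congestion of the flow is $NC(f)=\max_{v\in V\setminus\{t_1,\dots,t_k\}}NC(v)$. "With high probability" means with probability at least $1-n^{-c}$ for a constant $c$, where $n=|V|$.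
   Formalization: The number κ of non-zero supplies is at least 2, and the constant in the O may depend on a positive lower bound δ on NC(f) when NC(f) is non-zero; with an absolute constant the claim fails by scaling the supplies to 0, and for κ = 1 the bound would be 0. *)

theory Defs
  imports
    "Graph_Theory.Pair_Digraph"
    "HOL-Probability.Probability_Mass_Function"
    "HOL-Library.Nat_Bijection"
begin

section \<open>Networks and flows\<close>

record 'v network =
  graph :: "'v pair_pre_digraph"
  sinks :: "'v set"
  node_supply :: "'v \<Rightarrow> real"
  arc_cap :: "'v \<times> 'v \<Rightarrow> real"
  node_cap :: "'v \<Rightarrow> real"

abbreviation nodes :: "'v network \<Rightarrow> 'v set" where
  "nodes N \<equiv> pverts (graph N)"

abbreviation links :: "'v network \<Rightarrow> ('v \<times> 'v) set" where
  "links N \<equiv> parcs (graph N)"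

definition network :: "'v network \<Rightarrow> bool" where
  "network N \<longleftrightarrow>
     pair_fin_digraph (graph N) \<and>
     sinks N \<noteq> {} \<and> sinks N \<subseteq> nodes N \<and>
     (\<forall>v\<in>nodes N. 0 \<le> node_supply N v) \<and>
     (\<forall>e\<in>links N. 0 < arc_cap N e) \<and>
     (\<forall>v\<in>nodes N. 0 < node_cap N v)"

definition uncapacitated :: "'v network \<Rightarrow> bool" where
  "uncapacitated N \<longleftrightarrow>
     (\<forall>e\<in>links N. arc_cap N e = 1) \<and> (\<forall>v\<in>nodes N. node_cap N v = 1)"

definition sources :: "'v network \<Rightarrow> 'v set" where
  "sources N = {v \<in> nodes N. node_supply N v \<noteq> 0}"

definition outflow :: "'v network \<Rightarrow> ('v \<times> 'v \<Rightarrow> real) \<Rightarrow> 'v \<Rightarrow> real" where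
  "outflow N f v = (\<Sum>e\<in>out_arcs (with_proj (graph N)) v. f e)"

definition inflow :: "'v network \<Rightarrow> ('v \<times> 'v \<Rightarrow> real) \<Rightarrow> 'v \<Rightarrow> real" where
  "inflow N f v = (\<Sum>e\<in>in_arcs (with_proj (graph N)) v. f e)"

text \<open>
  A node injects at most its own supply, and only sinks absorb flow. Capacities do not bound
  the flow: they enter through the congestion, which is allowed to exceed 1.
\<close>

definition static_flow :: "'v network \<Rightarrow> ('v \<times> 'v \<Rightarrow> real) \<Rightarrow> bool" where
  "static_flow N f \<longleftrightarrow>
     (\<forall>e\<in>links N. 0 \<le> f e) \<and>
     (\<forall>v\<in>nodes N. outflow N f v \<le> inflow N f v + node_supply N v) \<and>
     (\<forall>v\<in>nodes N - sinks N. inflow N f v \<le> outflow N f v)"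

text \<open>
  Since only sinks absorb flow, the net outflow of a non-sink node is the amount of its supply
  that reaches the sinks. Supply located at a sink is already there.
\<close>

definition satisfiable :: "real \<Rightarrow> 'v network \<Rightarrow> ('v \<times> 'v \<Rightarrow> real) \<Rightarrow> bool" where
  "satisfiable \<beta> N f \<longleftrightarrow>
     static_flow N f \<and>
     (\<forall>v\<in>nodes N - sinks N. \<beta> * node_supply N v \<le> outflow N f v - inflow N f v)"

definition confluent :: "'v network \<Rightarrow> ('v \<times> 'v \<Rightarrow> real) \<Rightarrow> bool" where
  "confluent N f \<longleftrightarrow>
     (\<forall>v\<in>nodes N - sinks N. \<exists>e. \<forall>e'\<in>out_arcs (with_proj (graph N)) v. e' \<noteq> e \<longrightarrow> f e' = 0)"

definition node_congestion :: "'v network \<Rightarrow> ('v \<times> 'v \<Rightarrow> real) \<Rightarrow> 'v \<Rightarrow> real" where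
  "node_congestion N f v = outflow N f v / node_cap N v"

text \<open>The additional 0 only matters when every node is a sink.\<close>

definition congestion :: "'v network \<Rightarrow> ('v \<times> 'v \<Rightarrow> real) \<Rightarrow> real" where
  "congestion N f = Max (insert 0 (node_congestion N f ` (nodes N - sinks N)))"


section \<open>Randomized algorithms\<close>

text \<open>
  The total recursive functions of one argument, with several arguments packed by
  \<^const>\<open>prod_encode\<close>: initial functions, composition, pairing, primitive recursion, and
  minimisation of functions that have a zero for every parameter.
\<close>

inductive computable :: "(nat \<Rightarrow> nat) \<Rightarrow> bool" where
  zero: "computable (\<lambda>_. 0)"
| succ: "computable Suc"
| ident: "computable (\<lambda>x. x)"
| proj1: "computable (\<lambda>x. fst (prod_decode x))"
| proj2: "computable (\<lambda>x. snd (prod_decode x))"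
| comp: "computable f \<Longrightarrow> computable g \<Longrightarrow> computable (\<lambda>x. f (g x))"
| pair: "computable f \<Longrightarrow> computable g \<Longrightarrow> computable (\<lambda>x. prod_encode (f x, g x))"
| prim_rec: "computable f \<Longrightarrow> computable g \<Longrightarrow>
    computable (\<lambda>x. case prod_decode x of (a, n) \<Rightarrow>
      rec_nat (f a) (\<lambda>m r. g (prod_encode (a, prod_encode (m, r)))) n)"
| minimise: "computable f \<Longrightarrow> (\<And>a. \<exists>n. f (prod_encode (a, n)) = 0) \<Longrightarrow>
    computable (\<lambda>a. LEAST n. f (prod_encode (a, n)) = 0)"

text \<open>
  On input \<open>x\<close> the algorithm tosses \<open>l x\<close> fair coins, reads the outcome as a number below
  \<open>2 ^ l x\<close>, and then computes its output deterministically.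
\<close>

definition randomized_algorithm :: "(nat \<Rightarrow> nat pmf) \<Rightarrow> bool" where
  "randomized_algorithm R \<longleftrightarrow>
     (\<exists>g l. computable g \<and> computable l \<and>
        R = (\<lambda>x. map_pmf (\<lambda>r. g (prod_encode (x, r))) (pmf_of_set {..<2 ^ l x})))"


section \<open>Input and output of the algorithm\<close>

text \<open>
  When the network is uncapacitated and its non-zero supplies are equal, it is determined, up
  to the unit in which flow is measured, by the following finite sets.
\<close>

definition encode_network :: "nat network \<Rightarrow> nat" where
  "encode_network N =
     prod_encode (set_encode (nodes N),
     prod_encode (set_encode (prod_encode ` links N),
     prod_encode (set_encode (sinks N), set_encode (sources N))))"

text \<open>
  The output is a list of multiplicities indexed by the codes of the arcs (missing entries
  count as 0). The flow is obtained by multiplying with the common supply \<open>d\<close>.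
\<close>

definition decode_flow :: "real \<Rightarrow> nat \<Rightarrow> nat \<times> nat \<Rightarrow> real" where
  "decode_flow d y e =
     (let ms = list_decode y; i = prod_encode e
      in if i < length ms then d * real (ms ! i) else 0)"

end

theory Submission
  imports Defs
begin

text \<open>
  Scale the flow so that every node has throughput at most 1. Sinks do not count towards the
  congestion, so the nodes with an arc into a sink act as roots whose loads have to stay small.
  Directed cycles, and alternating cycles through roots that are entered by at least two
  nodes, can be cancelled in the direction that only decreases throughputs. A node whose whole flow
  enters one root is merged into that root. The only step that changes loads occurs at a node that
  feeds two roots, one of which it feeds alone: either the flow into the other root is diverted to
  this one, or this root is given up. A potential that is linear up to 2 and then doubles with every
  unit never increases, and it is at most \<open>\<kappa>\<close> initially, so no load exceeds \<open>1 + log 2 \<kappa>\<close>.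

  The factor \<open>1 / \<delta>\<close> in the constant turns this bound into the required one. Since the model of
  computation bounds no resources, a deterministic exhaustive search for an integral confluent flow of least
  congestion succeeds with probability 1.
\<close>

section \<open>The potential of a load\<close>

text \<open>The shape of the potential comes from the two ways to treat a node that sends
  \<open>a\<close> into a root of load x, which it alone feeds, and \<open>c\<close> into a root of
  load y. If c \<le> y - x, diverting \<open>c\<close> leaves both loads between x and y, and
  convexity suffices. Otherwise y - x < c \<le> 1 - a, because the throughput of the node is at most
  1. When the first root is given up, the new load y + a of the second one is then at most 1 above
  each of x and y, and a function that doubles with every unit pays for the increase with the
  potential that disappears. A linear start makes the initial sum of potentials equal to the total
  load, hence at most one unit per source. The two formulas agree at 1 and at 2; only a change at 2
  is convex, since there the slope rises from 1 to 2 ln 2, whereas at 1 it would fall to ln 2.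

  Only roots need a potential: in the rounded flow the throughput of a forwarding node ends up
  undivided in a root, whose load therefore bounds it.\<close>

definition potential :: "real \<Rightarrow> real" where
  "potential x = (if x \<le> 2 then x else 2 powr (x - 1))"

lemma convex_powr_two: "convex_on UNIV (\<lambda>x::real. 2 powr (x - 1))"
proof (rule f''_ge0_imp_convex)
  show "((\<lambda>x. 2 powr (x - 1)) has_real_derivative ln 2 * 2 powr (x - 1)) (at x)" for x :: real
    by (auto intro!: derivative_eq_intros)
  show "((\<lambda>x. ln 2 * 2 powr (x - 1)) has_real_derivative ln 2 * (ln 2 * 2 powr (x - 1))) (at x)" for x :: real
    by (auto intro!: derivative_eq_intros)
qed auto

text \<open>Chord bound for the convex power between 1 and 2, the two points where it agrees with
  the identity.\<close>

lemma powr_two_le: "2 powr (x - 1) \<le> x" if "1 \<le> x" "x \<le> 2" for x :: real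
  using convex_onD[OF convex_powr_two, of "x - 1" 1 2] that by (simp add: algebra_simps)

lemma powr_two_diff_mono:
  fixes x y :: real
  assumes "2 \<le> x" "x \<le> y"
  shows "2 powr (x - 1) - x \<le> 2 powr (y - 1) - y"
proof (rule DERIV_nonneg_imp_nondecreasing[OF assms(2)])
  fix t assume t: "x \<le> t" "t \<le> y"
  have "ln 2 \<ge> (1 / 2 :: real)" using ln2_ge_two_thirds by simp
  moreover have "2 powr (t - 1) \<ge> (2::real)" using t assms(1) powr_mono[of 1 "t - 1" 2] by simp
  ultimately have "ln 2 * 2 powr (t - 1) \<ge> (1 / 2) * (2::real)" by (intro mult_mono) auto
  then show "\<exists>D. ((\<lambda>t. 2 powr (t - 1) - t) has_real_derivative D) (at t) \<and> 0 \<le> D"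
    by (intro exI[of _ "ln 2 * 2 powr (t - 1) - 1"]) (auto intro!: derivative_eq_intros)
qed

lemma powr_two_ge: "x \<le> 2 powr (x - 1)" if "2 \<le> x" for x :: real
  using powr_two_diff_mono[of 2 x] that by simp

lemma potential_ge: "x \<le> potential x"
  using powr_two_ge[of x] by (auto simp: potential_def)

lemma potential_ge_powr: "2 powr (x - 1) \<le> potential x" if "1 \<le> x"
  using powr_two_le[of x] that by (auto simp: potential_def)

text \<open>The second summand is a convex function, nondecreasing from 2 on, of the convex
  \<open>max x 2\<close>. This form yields both convexity and monotonicity without cases at the
  breakpoint.\<close>

lemma potential_eq: "potential x = x + (2 powr (max x 2 - 1) - max x 2)"
  by (auto simp: potential_def max_def)

lemma convex_potential: "convex_on UNIV potential"
proof (rule convex_onI)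
  fix t x y :: real
  assume t: "0 < t" "t < 1"
  let ?h = "\<lambda>z::real. 2 powr (z - 1) - z"
  let ?x = "max x 2" and ?y = "max y 2"
  have "(1 - t) * 2 \<le> (1 - t) * ?x" "t * 2 \<le> t * ?y" "(1 - t) * x \<le> (1 - t) * ?x" "t * y \<le> t * ?y"
    using t by (auto intro!: mult_left_mono simp del: left_diff_distrib_numeral right_diff_distrib_numeral)
  then have "max ((1 - t) * x + t * y) 2 \<le> (1 - t) * ?x + t * ?y"
    by (intro max.boundedI) (linarith, simp add: left_diff_distrib)
  then have "?h (max ((1 - t) * x + t * y) 2) \<le> ?h ((1 - t) * ?x + t * ?y)"
    by (intro powr_two_diff_mono) auto
  also have "\<dots> \<le> (1 - t) * ?h ?x + t * ?h ?y"
    using convex_onD[OF convex_powr_two, of t ?x ?y] t by (simp add: algebra_simps)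
  finally show "potential ((1 - t) *\<^sub>R x + t *\<^sub>R y) \<le> (1 - t) * potential x + t * potential y"
    unfolding potential_eq by (simp add: algebra_simps)
qed auto

lemma potential_mono: "x \<le> y \<Longrightarrow> potential x \<le> potential y"
  using powr_two_diff_mono[of "max x 2" "max y 2"] unfolding potential_eq by (smt (verit))

lemma potential_nonneg: "0 \<le> x \<Longrightarrow> 0 \<le> potential x"
  using potential_ge[of x] by linarith

text \<open>The new loads lie between x and y and have the same sum, so they are convex combinations
  of x and y with exchanged weights.\<close>

lemma potential_transfer:
  assumes "0 \<le> c" "c \<le> y - x"
  shows "potential (x + c) + potential (y - c) \<le> potential x + potential y"
proof (cases "x = y")
  case False
  define t where "t = c / (y - x)"
  have t: "0 \<le> t" "t \<le> 1" "t * (y - x) = c" using assms False by (auto simp: t_def)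
  have eq: "x + c = (1 - t) * x + t * y" "y - c = (1 - t) * y + t * x"
    using t(3) by (auto simp: algebra_simps)
  have "potential (x + c) \<le> (1 - t) * potential x + t * potential y"
    "potential (y - c) \<le> (1 - t) * potential y + t * potential x"
    unfolding eq using convex_onD[OF convex_potential t(1,2)] by auto
  then show ?thesis by (simp add: algebra_simps)
qed (use assms in auto)

text \<open>Here x is the load of a root that is given up, and \<open>a\<close> is its inflow. Since
  y + a - 1 is at most x and at most y, half of the exponential \<open>potential (y + a)\<close> is
  bounded by each old potential. In the linear range a \<le> x is enough.\<close>

lemma potential_absorb:
  assumes "0 \<le> a" "a \<le> 1" "a \<le> x" "y - x \<le> 1 - a"
  shows "potential (y + a) \<le> potential x + potential y"
proof (cases "y + a \<le> 2")
  case True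
  then show ?thesis using potential_ge[of x] potential_ge[of y] assms by (simp add: potential_def)
next
  case False
  have "potential (y + a) = 2 * 2 powr (y + a - 2)"
    using False powr_add[of 2 1 "y + a - 2"] by (simp add: potential_def)
  moreover have "2 powr (y + a - 2) \<le> 2 powr (x - 1)" "2 powr (y + a - 2) \<le> 2 powr (y - 1)"
    using assms by auto
  ultimately show ?thesis
    using potential_ge_powr[of x] potential_ge_powr[of y] assms False by linarith
qed

lemma potential_le_imp_le:
  assumes "potential x \<le> k" "2 \<le> k"
  shows "x \<le> 1 + log 2 k"
proof (cases "x \<le> 2")
  case True
  have "1 \<le> log 2 k" using assms(2) by simp
  then show ?thesis using True by linarith
next
  case False
  then have "2 powr (x - 1) \<le> k" using assms by (simp add: potential_def)
  then have "x - 1 \<le> log 2 k" using assms(2) by (simp add: le_log_iff)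
  then show ?thesis by simp
qed

section \<open>Rounding a flow with unit throughputs\<close>

text \<open>The first return of the walk closes the cycle; \<open>nx\<close> maps each of its vertices to the next one.\<close>

lemma walk_simple_cycle:
  fixes x :: "nat \<Rightarrow> 'a"
  assumes fin: "finite A" and A: "\<And>k. x k \<in> A"
    and step: "\<And>k. E (x k) (x (Suc k))"
    and nonbacktracking: "\<And>k. x k \<in> R \<or> x (Suc k) \<in> R \<Longrightarrow> x (Suc (Suc k)) \<noteq> x k"
    and irr: "\<And>r. r \<in> R \<Longrightarrow> \<not> E r r"
  obtains C nx where "C \<subseteq> A" "C \<noteq> {}" "bij_betw nx C C" "\<And>u. u \<in> C \<Longrightarrow> E u (nx u)"
    "\<And>u. u \<in> C \<Longrightarrow> u \<in> R \<Longrightarrow> nx (nx u) \<noteq> u"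
proof -
  have "\<not> inj x"
    using fin A by (meson finite_imageD finite_subset image_subsetI infinite_UNIV_nat)
  then have ex: "\<exists>j. \<exists>i<j. x i = x j"
    by (metis injI linorder_neqE_nat)
  define j where "j = (LEAST j. \<exists>i<j. x i = x j)"
  obtain i where i: "i < j" "x i = x j"
    using LeastI_ex[OF ex] unfolding j_def by blast
  have least: "\<not> (\<exists>i<k. x i = x k)" if "k < j" for k
    using not_less_Least[of k "\<lambda>j. \<exists>i<j. x i = x j"] that unfolding j_def by blast
  have inj: "inj_on x {i..<j}"
    by (rule inj_onI) (metis atLeastLessThan_iff least linorder_neqE_nat)
  define C where "C = x ` {i..<j}"
  define nx where "nx u = x (Suc (the_inv_into {i..<j} x u))" for u
  have nx: "nx (x k) = x (Suc k)" if "i \<le> k" "k < j" for k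
    using that by (simp add: nx_def the_inv_into_f_f[OF inj])
  have mem: "x (Suc k) \<in> C" if "i \<le> k" "k < j" for k
    using that i unfolding C_def
    by (cases "Suc k = j") (metis atLeastLessThan_iff imageI le_refl, auto)
  have "nx ` C = C"
  proof
    show "nx ` C \<subseteq> C" using nx mem by (auto simp: C_def)
    show "C \<subseteq> nx ` C"
    proof
      fix u assume "u \<in> C"
      then obtain k where k: "u = x k" "i \<le> k" "k < j" by (auto simp: C_def)
      show "u \<in> nx ` C"
      proof (cases "k = i")
        case True
        have "nx (x (j - 1)) = x j" using nx[of "j - 1"] i by simp
        moreover have "x (j - 1) \<in> C" unfolding C_def using i by (intro imageI) auto
        ultimately show ?thesis using k True i by (metis image_eqI)
      next
        case False
        then have "nx (x (k - 1)) = x k" using nx[of "k - 1"] k by simp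
        moreover have "x (k - 1) \<in> C" unfolding C_def using k False by (intro imageI) auto
        ultimately show ?thesis using k by (metis image_eqI)
      qed
    qed
  qed
  then have "bij_betw nx C C"
    by (intro bij_betw_imageI) (auto simp: C_def intro: finite_surj_inj)
  moreover have "E u (nx u)" if "u \<in> C" for u
    using that step nx by (auto simp: C_def)
  moreover have "nx (nx u) \<noteq> u" if u: "u \<in> C" "u \<in> R" for u
  proof -
    obtain k where k: "u = x k" "i \<le> k" "k < j" using u(1) by (auto simp: C_def)
    show ?thesis
    proof (cases "Suc k < j")
      case True
      then show ?thesis using nx[of k] nx[of "Suc k"] nonbacktracking[of k] u k by auto
    next
      case False
      then have j: "j = Suc k" using k by simp
      have n1: "nx u = x i" using nx[of k] k i j by simp
      have n2: "nx (x i) = x (Suc i)" using nx[of i] i(1) by simp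
      show ?thesis
      proof
        \<comment> \<open>The cycle would have length 1, a loop at a member of \<open>R\<close>, or
          length 2, and then the walk would have turned back at \<open>u\<close>.\<close>
        assume "nx (nx u) = u"
        then have e: "x (Suc i) = x k" using n1 n2 k by simp
        have "k \<noteq> i" using irr[OF u(2)] step[of k] i j k by auto
        then have "Suc i = k" using inj_onD[OF inj e] i j k by auto
        then show False using nonbacktracking[of i] u k i j by auto
      qed
    qed
  qed
  ultimately show ?thesis using that[of C nx] i A by (auto simp: C_def)
qed

text \<open>
  Flow is measured in units of the largest throughput, so that \<open>q\<close> is the common supply of the
  sources, and \<open>X v\<close> is the number of sources merged into \<open>v\<close>. Nodes in \<open>U\<close> forward their flow,
  roots in \<open>S\<close> absorb it.
\<close>

definition routing ::
    "'a set \<Rightarrow> real \<Rightarrow> 'a set \<Rightarrow> 'a set \<Rightarrow> ('a \<Rightarrow> nat) \<Rightarrow> ('a \<Rightarrow> 'a \<Rightarrow> real) \<Rightarrow> bool" where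
  "routing V q U S X g \<longleftrightarrow>
     finite V \<and> 0 < q \<and> U \<subseteq> V \<and> S \<subseteq> V \<and> U \<inter> S = {} \<and>
     (\<forall>u w. 0 \<le> g u w) \<and> (\<forall>u w. g u w \<noteq> 0 \<longrightarrow> u \<in> U \<and> w \<in> U \<union> S) \<and>
     (\<forall>u\<in>U. (\<Sum>w\<in>V. g u w) = (\<Sum>v\<in>V. g v u) + q * real (X u) \<and> (\<Sum>w\<in>V. g u w) \<le> 1)"

definition load :: "'a set \<Rightarrow> real \<Rightarrow> ('a \<Rightarrow> nat) \<Rightarrow> ('a \<Rightarrow> 'a \<Rightarrow> real) \<Rightarrow> 'a \<Rightarrow> real" where
  "load V q X g s = (\<Sum>v\<in>V. g v s) + q * real (X s)"

definition supp :: "('a \<Rightarrow> 'a \<Rightarrow> 'b::zero) \<Rightarrow> ('a \<times> 'a) set" where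
  "supp g = {(u, w). g u w \<noteq> 0}"

lemma supp_psubsetI:
  assumes "supp g' \<subseteq> supp g" "g' u w = 0" "g u w \<noteq> 0"
  shows "supp g' \<subset> supp g"
proof -
  have "(u, w) \<in> supp g - supp g'" using assms(2,3) by (simp add: supp_def)
  then show ?thesis using assms(1) by blast
qed

lemma routingD:
  assumes "routing V q U S X g"
  shows "finite V" "0 < q" "U \<subseteq> V" "S \<subseteq> V" "U \<inter> S = {}" "0 \<le> g u w"
    "g u w \<noteq> 0 \<Longrightarrow> u \<in> U" "g u w \<noteq> 0 \<Longrightarrow> w \<in> U \<union> S"
    "u \<in> U \<Longrightarrow> (\<Sum>w\<in>V. g u w) = (\<Sum>v\<in>V. g v u) + q * real (X u)"
    "u \<in> U \<Longrightarrow> (\<Sum>w\<in>V. g u w) \<le> 1" "finite (supp g)"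
proof -
  have "supp g \<subseteq> V \<times> V" using assms unfolding routing_def supp_def by blast
  moreover have "finite (V \<times> V)" using assms unfolding routing_def by blast
  ultimately show "finite (supp g)" by (rule finite_subset)
  have a: "U \<inter> S = {}" "U \<subseteq> V" "S \<subseteq> V" "finite V" "0 < q" "\<forall>u w. 0 \<le> g u w"
      "\<forall>u w. g u w \<noteq> 0 \<longrightarrow> u \<in> U \<and> w \<in> U \<union> S"
      "\<forall>u\<in>U. (\<Sum>w\<in>V. g u w) = (\<Sum>v\<in>V. g v u) + q * real (X u) \<and> (\<Sum>w\<in>V. g u w) \<le> 1"
    using assms unfolding routing_def by blast+
  show "finite V" "0 < q" "U \<subseteq> V" "S \<subseteq> V" "U \<inter> S = {}" "0 \<le> g u w" using a by simp_all
  show "u \<in> U" "w \<in> U \<union> S" if "g u w \<noteq> 0" using a(7) that by blast+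
  show "(\<Sum>w\<in>V. g u w) = (\<Sum>v\<in>V. g v u) + q * real (X u)" "(\<Sum>w\<in>V. g u w) \<le> 1" if "u \<in> U"
    using bspec[OF a(8) that] by simp_all
qed

text \<open>
  Lowering the flow on the arcs that the cycle follows forwards and raising it on the arcs into
  roots that it follows backwards keeps the load of every root and raises the throughput of no node.
\<close>

lemma routing_cancel_cycle:
  assumes rt: "routing V q U S X g"
    and C: "C \<subseteq> U \<union> S" "C \<noteq> {}" "bij_betw nx C C"
    and fwd: "\<And>u. u \<in> C \<Longrightarrow> u \<in> U \<Longrightarrow> g u (nx u) \<noteq> 0"
    and bwd: "\<And>s. s \<in> C \<Longrightarrow> s \<in> S \<Longrightarrow> g (nx s) s \<noteq> 0"
    and nb: "\<And>s. s \<in> C \<Longrightarrow> s \<in> S \<Longrightarrow> nx (nx s) \<noteq> s"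
  obtains g' where "routing V q U S X g'" "\<And>s. s \<in> S \<Longrightarrow> load V q X g' s = load V q X g s"
    "supp g' \<subset> supp g"
proof -
  note R = routingD[OF rt]
  have CV: "C \<subseteq> V" using C R(3,4) by auto
  have finC: "finite C" using CV R(1) finite_subset by blast
  have nxC: "nx u \<in> C" if "u \<in> C" for u using C(3) that by (auto simp: bij_betw_def)
  define p where "p = inv_into C nx"
  have pC: "p u \<in> C" and nxp: "nx (p u) = u" if "u \<in> C" for u
    using C(3) that unfolding p_def bij_betw_def by (auto intro: inv_into_into f_inv_into_f)
  have pnx: "p (nx u) = u" if "u \<in> C" for u
    using C(3) that unfolding p_def bij_betw_def by auto
  have pV: "p u \<in> V" if "u \<in> C" for u using pC[OF that] CV by auto
  \<comment> \<open>Both neighbours of a root on the cycle are forwarding nodes, because all arcs of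
    the support start in \<open>U\<close>.\<close>
  have nxS: "nx s \<in> U" if "s \<in> C" "s \<in> S" for s using bwd[OF that] R(7) by blast
  have pS: "p s \<in> U" if "s \<in> C" "s \<in> S" for s
    using nxS[of "p s"] pC[OF that(1)] nxp[OF that(1)] that C(1) R(5) by auto
  \<comment> \<open>Arcs followed backwards gain flow, so only those followed forwards limit the
    amount.\<close>
  define t where "t = Min ((\<lambda>u. g u (nx u)) ` (C \<inter> U))"
  have ne: "C \<inter> U \<noteq> {}" using C(1,2) nxS nxC by blast
  have t_le: "t \<le> g u (nx u)" if "u \<in> C" "u \<in> U" for u
    unfolding t_def using finC that by (intro Min_le) auto
  have "t \<in> (\<lambda>u. g u (nx u)) ` (C \<inter> U)"
    unfolding t_def using finC ne by (intro Min_in) auto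
  then obtain u0 where u0: "u0 \<in> C" "u0 \<in> U" "t = g u0 (nx u0)" by auto
  have t0: "0 \<le> t" using u0 R(6) by simp
  define g' where "g' v w = g v w + t * (of_bool (w \<in> C \<and> w \<in> S \<and> nx w = v)
    - of_bool (v \<in> C \<and> v \<in> U \<and> nx v = w))" for v w
  have single: "(\<Sum>w\<in>V. of_bool (P \<and> w = a)) = (of_bool P :: real)" if "P \<Longrightarrow> a \<in> V" for P a
    using that R(1) by (cases P) (auto simp: of_bool_def)
  have row1: "(\<Sum>w\<in>V. of_bool (w \<in> C \<and> w \<in> S \<and> nx w = v)) = (of_bool (v \<in> C \<and> p v \<in> S) :: real)" for v
  proof -
    have "(w \<in> C \<and> w \<in> S \<and> nx w = v) = ((v \<in> C \<and> p v \<in> S) \<and> w = p v)" for w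
      using pC nxp pnx nxC by auto
    then show ?thesis using single[of "v \<in> C \<and> p v \<in> S" "p v"] pV by auto
  qed
  have col1: "(\<Sum>w\<in>V. of_bool (w \<in> C \<and> w \<in> U \<and> nx w = v)) = (of_bool (v \<in> C \<and> p v \<in> U) :: real)" for v
  proof -
    have "(w \<in> C \<and> w \<in> U \<and> nx w = v) = ((v \<in> C \<and> p v \<in> U) \<and> w = p v)" for w
      using pC nxp pnx nxC by auto
    then show ?thesis using single[of "v \<in> C \<and> p v \<in> U" "p v"] pV by auto
  qed
  have row2: "(\<Sum>w\<in>V. of_bool (v \<in> C \<and> v \<in> T \<and> nx v = w)) = (of_bool (v \<in> C \<and> v \<in> T) :: real)" for v T
  proof -
    have "(v \<in> C \<and> v \<in> T \<and> nx v = w) = ((v \<in> C \<and> v \<in> T) \<and> w = nx v)" for w by auto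
    then show ?thesis using single[of "v \<in> C \<and> v \<in> T" "nx v"] subsetD[OF CV nxC] by auto
  qed
  \<comment> \<open>At a forwarding node of the cycle, outflow and inflow both drop by
    \<open>t\<close> if its predecessor forwards, and neither changes if its predecessor is a root.
    At a root, the lowered and the raised arc balance.\<close>
  have out: "(\<Sum>w\<in>V. g' v w) = (\<Sum>w\<in>V. g v w) + t * (of_bool (v \<in> C \<and> p v \<in> S) - of_bool (v \<in> C \<and> v \<in> U))" for v
    unfolding g'_def by (simp only: sum.distrib sum_subtractf sum_distrib_left[symmetric] row1 row2)
  have inn: "(\<Sum>v\<in>V. g' v w) = (\<Sum>v\<in>V. g v w) + t * (of_bool (w \<in> C \<and> w \<in> S) - of_bool (w \<in> C \<and> p w \<in> U))" for w
    unfolding g'_def by (simp only: sum.distrib sum_subtractf sum_distrib_left[symmetric] col1 row2)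
  have sub: "g v w \<noteq> 0" if "g' v w \<noteq> 0" for v w
  proof
    assume "g v w = 0"
    then have "\<not> (w \<in> C \<and> w \<in> S \<and> nx w = v)" "\<not> (v \<in> C \<and> v \<in> U \<and> nx v = w)"
      using fwd bwd by blast+
    then show False using that \<open>g v w = 0\<close> by (auto simp: g'_def of_bool_def split: if_splits)
  qed
  have nonneg: "0 \<le> g' v w" for v w
  proof (cases "v \<in> C \<and> v \<in> U \<and> nx v = w")
    case True
    then show ?thesis using t_le[of v] t0 by (auto simp: g'_def of_bool_def)
  qed (use t0 R(6) in \<open>auto simp: g'_def\<close>)
  \<comment> \<open>By \<open>nb\<close>, the arc that attains the minimum is not raised as well, so
    it really leaves the support.\<close>
  have "g' u0 (nx u0) = 0"
    using u0 nb[of "nx u0"] nxC by (auto simp: g'_def)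
  moreover have "g u0 (nx u0) \<noteq> 0" using fwd u0 by simp
  moreover have "supp g' \<subseteq> supp g" using sub by (auto simp: supp_def)
  ultimately have "supp g' \<subset> supp g" by (intro supp_psubsetI)
  moreover have "routing V q U S X g'"
    unfolding routing_def
  proof (intro conjI allI impI ballI)
    fix u assume u: "u \<in> U"
    have d: "u \<in> C \<Longrightarrow> (p u \<in> S) = (p u \<notin> U)" "u \<notin> S" using pC C(1) R(5) u by auto
    show "(\<Sum>w\<in>V. g' u w) = (\<Sum>v\<in>V. g' v u) + q * real (X u)"
      unfolding out inn R(9)[OF u] using u d by (cases "u \<in> C") (auto simp: algebra_simps)
    have "(\<Sum>w\<in>V. g' u w) \<le> (\<Sum>w\<in>V. g u w)"
      unfolding out using u t0 by auto
    then show "(\<Sum>w\<in>V. g' u w) \<le> 1" using R(10)[OF u] by linarith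
  qed (use R(1-5) nonneg R(7,8)[OF sub] in auto)
  moreover have "load V q X g' s = load V q X g s" if "s \<in> S" for s
    unfolding load_def inn using that pS by (cases "s \<in> C") auto
  ultimately show ?thesis using that by blast
qed

text \<open>An endless walk yields a cycle to cancel: it goes forward from nodes of
  \<open>U\<close>, backward from roots, and never straight back from or to a root. A root with a
  single feeder would be a dead end. By \<open>shared\<close> this feeder feeds no other root, and
  by \<open>branch\<close> it has another arc, which therefore leads into \<open>U\<close>; so dead
  ends can be avoided.\<close>

lemma routing_reduce_support:
  assumes rt: "routing V q U S X g" and "U \<noteq> {}"
    and out: "\<And>u. u \<in> U \<Longrightarrow> \<exists>w. g u w \<noteq> 0"
    and branch: "\<And>u s. s \<in> S \<Longrightarrow> g u s \<noteq> 0 \<Longrightarrow> \<exists>w. w \<noteq> s \<and> g u w \<noteq> 0"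
    and shared: "\<And>u s s'. s \<in> S \<Longrightarrow> s' \<in> S \<Longrightarrow> s' \<noteq> s \<Longrightarrow> g u s \<noteq> 0 \<Longrightarrow> g u s' \<noteq> 0 \<Longrightarrow>
      \<exists>v. v \<noteq> u \<and> g v s \<noteq> 0"
  obtains g' where "routing V q U S X g'" "\<And>s. s \<in> S \<Longrightarrow> load V q X g' s = load V q X g s"
    "supp g' \<subset> supp g"
proof -
  note R = routingD[OF rt]
  \<comment> \<open>\<open>NT\<close> marks the places the walk may enter. A root has to be left
    against an arc other than the one used to reach it.\<close>
  define NT where "NT w \<longleftrightarrow> w \<in> U \<or> w \<in> S \<and> (\<forall>u. g u w \<noteq> 0 \<longrightarrow> (\<exists>v. v \<noteq> u \<and> g v w \<noteq> 0))" for w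
  define E where "E v w \<longleftrightarrow> v \<in> U \<and> g v w \<noteq> 0 \<or> v \<in> S \<and> g w v \<noteq> 0" for v w
  \<comment> \<open>\<open>a\<close> stands for the previous place of the walk; it restricts the
    next one only if it is a root.\<close>
  have exit: "\<exists>w. g u w \<noteq> 0 \<and> NT w \<and> (a \<in> S \<longrightarrow> w \<noteq> a)"
    if u: "u \<in> U" and a: "a \<in> S \<Longrightarrow> NT a \<and> g u a \<noteq> 0" for u a
  proof (cases "\<exists>s\<in>S. g u s \<noteq> 0 \<and> \<not> NT s")
    case True
    then obtain s where s: "s \<in> S" "g u s \<noteq> 0" "\<not> NT s" by blast
    then have only: "\<not> (\<exists>v. v \<noteq> u \<and> g v s \<noteq> 0)" unfolding NT_def by metis
    then have uniq: "s' = s" if "s' \<in> S" "g u s' \<noteq> 0" for s' using shared[of s s' u] s that by blast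
    obtain w where w: "w \<noteq> s" "g u w \<noteq> 0" using branch s by blast
    then have "w \<in> U" using R(8)[of u w] uniq by blast
    moreover have "a \<notin> S" using a uniq s(3) by blast
    ultimately show ?thesis using w by (auto simp: NT_def)
  next
    case False
    show ?thesis
    proof (cases "a \<in> S")
      case True
      then obtain w where "w \<noteq> a" "g u w \<noteq> 0" using branch[of a u] a by blast
      then show ?thesis using R(8)[of u w] False by (auto simp: NT_def)
    next
      case a': False
      obtain w where "g u w \<noteq> 0" using out[OF u] by blast
      then show ?thesis using a' R(8)[of u w] False by (auto simp: NT_def)
    qed
  qed
  let ?P = "\<lambda>(n::nat) (a, b). NT a \<and> NT b \<and> E a b"
  let ?Q = "\<lambda>(n::nat) (a, b) (b', c). b' = b \<and> (a \<in> S \<or> b \<in> S \<longrightarrow> c \<noteq> a)"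
  have "\<exists>f. \<forall>n. ?P n (f n) \<and> ?Q n (f n) (f (Suc n))"
  proof (rule dependent_nat_choice)
    obtain u where u: "u \<in> U" using \<open>U \<noteq> {}\<close> by blast
    \<comment> \<open>The walk has no previous place yet; \<open>u\<close> is a harmless substitute,
      not being a root.\<close>
    then obtain w where "g u w \<noteq> 0" "NT w" using exit[of u u] R(5) by blast
    then have "NT u \<and> NT w \<and> E u w" using u by (auto simp: NT_def E_def)
    then show "\<exists>x. ?P 0 x" by auto
  next
    fix x and n :: nat
    assume "?P n x"
    then obtain a b where x: "x = (a, b)" and ab: "NT a" "NT b" "E a b" by auto
    have "\<exists>c. NT c \<and> E b c \<and> (a \<in> S \<or> b \<in> S \<longrightarrow> c \<noteq> a)"
    proof (cases "b \<in> U")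
      case True
      then have "a \<in> S \<Longrightarrow> NT a \<and> g b a \<noteq> 0" using ab R(5) by (auto simp: E_def)
      then obtain c where "g b c \<noteq> 0" "NT c" "a \<in> S \<longrightarrow> c \<noteq> a" using exit True by blast
      then show ?thesis using True R(5) by (auto simp: E_def)
    next
      case False
      then have b: "b \<in> S" using ab by (auto simp: NT_def)
      have "g a b \<noteq> 0" using ab(3) False R(7) by (auto simp: E_def)
      then obtain v where "v \<noteq> a" "g v b \<noteq> 0" using ab(2) False by (auto simp: NT_def)
      then show ?thesis using b R(7) by (auto simp: E_def NT_def)
    qed
    then show "\<exists>y. ?P (Suc n) y \<and> ?Q n x y" using ab(2) x by auto
  qed
  then obtain f where f: "\<forall>n. ?P n (f n) \<and> ?Q n (f n) (f (Suc n))" ..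
  define x where "x n = fst (f n)" for n
  have snd: "snd (f n) = x (Suc n)" for n using spec[OF f, of n] by (auto simp: x_def split: prod.splits)
  have fn: "f n = (x n, x (Suc n))" for n using snd[of n] by (simp add: x_def prod_eq_iff)
  have NT: "NT (x n)" and E: "E (x n) (x (Suc n))"
    and nb: "x n \<in> S \<or> x (Suc n) \<in> S \<Longrightarrow> x (Suc (Suc n)) \<noteq> x n" for n
    using spec[OF f, of n] unfolding fn by (simp_all only: prod.case) blast+
  have fin: "finite (U \<union> S)" using R(1,3,4) by (meson finite_subset le_sup_iff)
  have mem: "x n \<in> U \<union> S" for n using NT by (auto simp: NT_def)
  have irr: "\<not> E r r" if "r \<in> S" for r using that R(5,7) by (auto simp: E_def)
  obtain C nx where C: "C \<subseteq> U \<union> S" "C \<noteq> {}" "bij_betw nx C C"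
      "\<And>u. u \<in> C \<Longrightarrow> E u (nx u)" "\<And>u. u \<in> C \<Longrightarrow> u \<in> S \<Longrightarrow> nx (nx u) \<noteq> u"
    by (rule walk_simple_cycle[where x = x and E = E and R = S, OF fin mem E nb irr];
        (assumption | (rule that; assumption)))
  have fwd: "g u (nx u) \<noteq> 0" if "u \<in> C" "u \<in> U" for u
    using C(4)[OF that(1)] that R(5) by (auto simp: E_def)
  have bwd: "g (nx s) s \<noteq> 0" if "s \<in> C" "s \<in> S" for s
    using C(4)[OF that(1)] that R(5) by (auto simp: E_def)
  show ?thesis by (rule routing_cancel_cycle[OF rt C(1-3) fwd bwd C(5)]; (assumption | (rule that; assumption)))
qed

text \<open>Confluence keeps supplies undivided, so \<open>h\<close> counts in units of
  \<open>q\<close>. The support condition lets a rounding of a reduced routing serve for the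
  original one.\<close>

definition confluent_rounding ::
    "'a set \<Rightarrow> 'a set \<Rightarrow> 'a set \<Rightarrow> ('a \<Rightarrow> nat) \<Rightarrow> nat \<Rightarrow> ('a \<Rightarrow> 'a \<Rightarrow> real) \<Rightarrow> ('a \<Rightarrow> 'a \<Rightarrow> nat) \<Rightarrow> bool" where
  "confluent_rounding V U S X m g h \<longleftrightarrow>
     supp h \<subseteq> supp g \<and> (\<forall>u\<in>U. \<exists>w. \<forall>w'. w' \<noteq> w \<longrightarrow> h u w' = 0) \<and>
     (\<forall>u\<in>U. (\<Sum>w\<in>V. h u w) = (\<Sum>v\<in>V. h v u) + X u \<and> (\<Sum>w\<in>V. h u w) \<le> m) \<and>
     (\<forall>s\<in>S. (\<Sum>v\<in>V. h v s) + X s \<le> m)"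

section \<open>Reductions of a routing and the way back for roundings\<close>

lemma confluent_rounding_mono:
  "confluent_rounding V U S X m g' h \<Longrightarrow> supp g' \<subseteq> supp g \<Longrightarrow> confluent_rounding V U S X m g h"
  unfolding confluent_rounding_def by blast

lemma routing_remove_isolated:
  assumes rt: "routing V q U S X g" and u: "u \<in> U" "\<And>w. g u w = 0"
  shows "routing V q (U - {u}) S X g"
    and "confluent_rounding V (U - {u}) S X m g h \<Longrightarrow> confluent_rounding V U S X m g h"
proof -
  note R = routingD[OF rt]
  have "0 = (\<Sum>v\<in>V. g v u) + q * real (X u)" using R(9)[OF u(1)] u(2) by simp
  moreover have "0 \<le> (\<Sum>v\<in>V. g v u)" "0 \<le> q * real (X u)" using R(2,6) by (auto intro: sum_nonneg)
  ultimately have z: "(\<Sum>v\<in>V. g v u) = 0" "q * real (X u) = 0" by linarith+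
  have Xu: "X u = 0" using z(2) R(2) by simp
  have gu: "g v u = 0" for v
    using z(1) R(1,3,6) R(7)[of v u] sum_nonneg_eq_0_iff[of V "\<lambda>v. g v u"] by (metis subsetD)
  show "routing V q (U - {u}) S X g"
    unfolding routing_def
  proof (intro conjI allI impI ballI)
    fix v w assume "g v w \<noteq> 0"
    moreover from this have "v \<noteq> u" "w \<noteq> u" using u(2) gu by auto
    ultimately show "v \<in> U - {u}" "w \<in> U - {u} \<union> S" using R(7,8) by blast+
  next
    fix v assume "v \<in> U - {u}"
    then have v: "v \<in> U" by simp
    show "(\<Sum>w\<in>V. g v w) = (\<Sum>w\<in>V. g w v) + q * real (X v)" "(\<Sum>w\<in>V. g v w) \<le> 1"
      by (fact R(9)[OF v], fact R(10)[OF v])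
  qed (use R(1-6) in auto)
  assume h: "confluent_rounding V (U - {u}) S X m g h"
  then have hu: "h u w = 0" "h v u = 0" for v w
    using u(2) gu unfolding confluent_rounding_def supp_def by blast+
  have "(\<exists>w. \<forall>w'. w' \<noteq> w \<longrightarrow> h v w' = 0) \<and>
      (\<Sum>w\<in>V. h v w) = (\<Sum>w\<in>V. h w v) + X v \<and> (\<Sum>w\<in>V. h v w) \<le> m" if "v \<in> U" for v
    using h that Xu hu unfolding confluent_rounding_def by (cases "v = u") (simp, blast)
  then show "confluent_rounding V U S X m g h"
    using h unfolding confluent_rounding_def by blast
qed

text \<open>Both arcs end in roots, where nothing has to be conserved, and the throughput of
  \<open>u\<close> stays the same; so only two loads change. The sign of \<open>t\<close> decides
  which root gains.\<close>

lemma routing_shift: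
  assumes rt: "routing V q U S X g" and s: "s \<in> S" "s' \<in> S" "s \<noteq> s'"
    and u: "g u s \<noteq> 0" "g u s' \<noteq> 0" and t: "- g u s \<le> t" "t \<le> g u s'"
  defines "g' \<equiv> \<lambda>v w. g v w + (if v = u then (if w = s then t else if w = s' then - t else 0) else 0)"
  shows "routing V q U S X g'" "load V q X g' s = load V q X g s + t"
    "load V q X g' s' = load V q X g s' - t"
    "\<And>r. r \<noteq> s \<Longrightarrow> r \<noteq> s' \<Longrightarrow> load V q X g' r = load V q X g r"
    "supp g' \<subseteq> supp g"
proof -
  note R = routingD[OF rt]
  have uU: "u \<in> U" "u \<in> V" using R(3,7) u by auto
  have sV: "s \<in> V" "s' \<in> V" using s R(4) by auto
  have "(\<Sum>w\<in>V. if v = u then (if w = s then t else if w = s' then - t else 0) else 0) = 0" for v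
  proof -
    have "(\<Sum>w\<in>V. if w = s then t else if w = s' then - t else 0)
      = (\<Sum>w\<in>V. (if w = s then t else 0) - (if w = s' then t else 0))"
      using s(3) by (intro sum.cong) auto
    also have "\<dots> = 0" using sV R(1) by (simp add: sum_subtractf)
    finally show ?thesis by (cases "v = u") (simp_all only: refl if_True if_False sum.neutral_const)
  qed
  then have out: "(\<Sum>w\<in>V. g' v w) = (\<Sum>w\<in>V. g v w)" for v
    unfolding g'_def by (simp add: sum.distrib)
  have inn: "(\<Sum>v\<in>V. g' v w) = (\<Sum>v\<in>V. g v w) + (if w = s then t else if w = s' then - t else 0)" for w
    unfolding g'_def using uU R(1) by (simp add: sum.distrib)
  have sub: "g v w \<noteq> 0" if "g' v w \<noteq> 0" for v w
    using that u by (auto simp: g'_def split: if_splits)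
  then show "supp g' \<subseteq> supp g" by (auto simp: supp_def)
  show "routing V q U S X g'"
    unfolding routing_def
  proof (intro conjI allI impI ballI)
    show "0 \<le> g' v w" for v w using R(6)[of v w] t by (auto simp: g'_def)
    fix v assume v: "v \<in> U"
    then have "v \<noteq> s" "v \<noteq> s'" using s R(5) by auto
    then show "(\<Sum>w\<in>V. g' v w) = (\<Sum>w\<in>V. g' w v) + q * real (X v)" "(\<Sum>w\<in>V. g' v w) \<le> 1"
      unfolding out inn using R(9,10)[OF v] by auto
  qed (use R(1-5) R(7,8)[OF sub] in auto)
  show "load V q X g' s = load V q X g s + t" "load V q X g' s' = load V q X g s' - t"
    "\<And>r. r \<noteq> s \<Longrightarrow> r \<noteq> s' \<Longrightarrow> load V q X g' r = load V q X g r"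
    unfolding load_def inn using s(3) by auto
qed

text \<open>A root without inflow may still hold merged sources. No rounding can enter it, so these
  sources are its whole final load.\<close>

lemma routing_remove_root:
  assumes rt: "routing V q U S X g" and s: "\<And>v. g v s = 0"
  shows "routing V q U (S - {s}) X g"
    and "confluent_rounding V U (S - {s}) X m g h \<Longrightarrow> X s \<le> m \<Longrightarrow> confluent_rounding V U S X m g h"
proof -
  note R = routingD[OF rt]
  show "routing V q U (S - {s}) X g"
    unfolding routing_def
  proof (intro conjI allI impI ballI)
    fix v w assume "g v w \<noteq> 0"
    moreover from this have "w \<noteq> s" using s by auto
    ultimately show "v \<in> U" "w \<in> U \<union> (S - {s})" using R(7,8) by blast+
  next
    fix v assume v: "v \<in> U"
    show "(\<Sum>w\<in>V. g v w) = (\<Sum>w\<in>V. g w v) + q * real (X v)" "(\<Sum>w\<in>V. g v w) \<le> 1"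
      by (fact R(9)[OF v], fact R(10)[OF v])
  qed (use R(1-6) in auto)
  assume h: "confluent_rounding V U (S - {s}) X m g h" "X s \<le> m"
  then have "h v s = 0" for v using s unfolding confluent_rounding_def supp_def by blast
  then show "confluent_rounding V U S X m g h"
    using h unfolding confluent_rounding_def by auto
qed

text \<open>Arcs into \<open>u\<close> are redirected to \<open>s\<close>, which also takes over the
  sources of \<open>u\<close>; by conservation at \<open>u\<close>, loads do not change. On the way
  back, a node reaches \<open>s\<close> through \<open>u\<close> exactly if it has no direct arc to
  \<open>s\<close>. This is one decision per node, so confluence and the support survive. The
  throughput of \<open>u\<close> is bounded since all of it enters \<open>s\<close>.\<close>

lemma routing_contract:
  assumes rt: "routing V q U S X g" and s: "s \<in> S" and u: "g u s \<noteq> 0" "\<And>w. w \<noteq> s \<Longrightarrow> g u w = 0"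
  defines "g' \<equiv> \<lambda>v w. if v = u \<or> w = u then 0 else if w = s then g v s + g v u else g v w"
    and "X' \<equiv> X(s := X s + X u)"
  shows "routing V q (U - {u}) S X' g'" "\<And>r. r \<in> S \<Longrightarrow> load V q X' g' r = load V q X g r"
    "card (supp g') \<le> card (supp g)"
    "confluent_rounding V (U - {u}) S X' m g' h' \<Longrightarrow> \<exists>h. confluent_rounding V U S X m g h"
proof -
  note R = routingD[OF rt]
  have "u \<in> U" using R(7) u(1) .
  then have uU: "u \<in> U" "u \<in> V" "s \<in> V" "u \<noteq> s" "s \<notin> U" using R(3,4,5) s by auto
  have split: "(\<Sum>w\<in>V. k w) = k u + k s + (\<Sum>w\<in>V - {u, s}. k w)" for k :: "_ \<Rightarrow> 'c::comm_monoid_add"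
    using uU R(1) by (simp add: sum.remove[of V u] sum.remove[of "V - {u}" s] Diff_insert2[symmetric] insert_commute add.assoc)
  have out: "(\<Sum>w\<in>V. g' v w) = (\<Sum>w\<in>V. g v w)" if "v \<noteq> u" for v
    unfolding split using that uU by (auto simp: g'_def add_ac intro!: sum.cong)
  have "(\<Sum>w\<in>V. g u w) = g u s" unfolding split using u(2) uU by simp
  then have us: "g u s = (\<Sum>v\<in>V. g v u) + q * real (X u)" using R(9)[OF uU(1)] by simp
  have inn: "(\<Sum>v\<in>V. g' v w) = (\<Sum>v\<in>V. g v w)" if "w \<noteq> u" "w \<noteq> s" for w
    using that u(2)[of w] by (intro sum.cong) (auto simp: g'_def)
  have "(\<Sum>v\<in>V. g' v s) = (\<Sum>v\<in>V. (g v s + g v u) - (if v = u then g u s else 0))"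
    using uU u(2)[of u] by (intro sum.cong) (auto simp: g'_def)
  then have inns: "(\<Sum>v\<in>V. g' v s) = (\<Sum>v\<in>V. g v s) + (\<Sum>v\<in>V. g v u) - g u s"
    using uU R(1) by (simp add: sum_subtractf sum.distrib)
  show "routing V q (U - {u}) S X' g'"
    unfolding routing_def
  proof (intro conjI allI impI ballI)
    show "0 \<le> g' v w" for v w using R(6) by (auto simp: g'_def)
    fix v w assume n: "g' v w \<noteq> 0"
    then have "v \<noteq> u" "w \<noteq> u" "w = s \<or> g v w \<noteq> 0" by (auto simp: g'_def split: if_splits)
    moreover have "\<exists>w. g v w \<noteq> 0" using n by (rule contrapos_np) (auto simp: g'_def)
    ultimately show "v \<in> U - {u}" "w \<in> U - {u} \<union> S" using R(7,8) s by blast+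
  next
    fix v assume "v \<in> U - {u}"
    then have v: "v \<in> U" "v \<noteq> u" "v \<noteq> s" using uU by auto
    then show "(\<Sum>w\<in>V. g' v w) = (\<Sum>w\<in>V. g' w v) + q * real (X' v)" "(\<Sum>w\<in>V. g' v w) \<le> 1"
      unfolding out[OF v(2)] inn[OF v(2,3)] using R(9,10)[OF v(1)] by (auto simp: X'_def)
  qed (use R(1-6) in auto)
  show "load V q X' g' r = load V q X g r" if "r \<in> S" for r
  proof (cases "r = s")
    case True
    then show ?thesis unfolding load_def True inns us by (simp add: X'_def algebra_simps)
  next
    case False
    moreover have "r \<noteq> u" using that uU R(5) by auto
    ultimately show ?thesis unfolding load_def by (simp add: inn X'_def)
  qed
  have "supp g' \<subseteq> (\<lambda>(v, w). (v, if w = u then s else w)) ` supp g"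
  proof
    fix e assume "e \<in> supp g'"
    then obtain v w where e: "e = (v, w)" "g' v w \<noteq> 0" by (auto simp: supp_def)
    show "e \<in> (\<lambda>(v, w). (v, if w = u then s else w)) ` supp g"
    proof (cases "g v w = 0")
      case True
      then have "w = s" "g v u \<noteq> 0" using e(2) by (auto simp: g'_def split: if_splits)
      then show ?thesis using e by (intro image_eqI[of _ _ "(v, u)"]) (auto simp: supp_def)
    next
      case False
      then show ?thesis using e by (intro image_eqI[of _ _ "(v, w)"]) (auto simp: supp_def g'_def)
    qed
  qed
  then show "card (supp g') \<le> card (supp g)"
    using R(11) by (meson card_image_le card_mono finite_imageI le_trans)
  assume h': "confluent_rounding V (U - {u}) S X' m g' h'"
  have h'0: "h' v w = 0" if "v = u \<or> w = u" for v w
    using h' that unfolding confluent_rounding_def supp_def g'_def by auto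
  define up where "up v = (if g v s = 0 then h' v s else 0)" for v
  define c where "c = X u + (\<Sum>v\<in>V. up v)"
  define h where "h v w = (if v = u then (if w = s then c else 0) else
    if w = u then up v else if w = s then h' v s - up v else h' v w)" for v w
  have up_le: "up v \<le> h' v s" "up u = 0" for v using h'0 by (auto simp: up_def)
  have outh: "(\<Sum>w\<in>V. h v w) = (\<Sum>w\<in>V. h' v w)" if "v \<noteq> u" for v
    unfolding split[of "h v"] split[of "h' v"] using that uU h'0 up_le(1)[of v] by (simp add: h_def)
  have outu: "(\<Sum>w\<in>V. h u w) = c"
    unfolding split[of "h u"] using uU by (simp add: h_def)
  have innh: "(\<Sum>v\<in>V. h v w) = (\<Sum>v\<in>V. h' v w)" if "w \<noteq> u" "w \<noteq> s" for w
    using that h'0 by (intro sum.cong) (auto simp: h_def)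
  have "(\<Sum>v\<in>V. h v u) = (\<Sum>v\<in>V. up v)"
    using uU up_le by (intro sum.cong) (auto simp: h_def)
  then have innu: "(\<Sum>v\<in>V. h v u) + X u = c" by (simp add: c_def)
  \<comment> \<open>\<open>h v s\<close> is a truncated difference of naturals; adding
    \<open>up v\<close> back avoids the subtraction.\<close>
  have "(\<Sum>v\<in>V. h v s + up v) = (\<Sum>v\<in>V. h' v s + (if v = u then c else 0))"
    using uU up_le h'0 by (intro sum.cong) (auto simp: h_def)
  then have inns: "(\<Sum>v\<in>V. h v s) + X s = (\<Sum>v\<in>V. h' v s) + X' s"
    using uU R(1) by (simp add: sum.distrib c_def X'_def)
  have "(\<Sum>v\<in>V. h v s) + X s \<le> m"
    unfolding inns using h' s by (auto simp: confluent_rounding_def)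
  moreover have "c \<le> (\<Sum>v\<in>V. h v s)"
    using member_le_sum[of u V "\<lambda>v. h v s"] uU R(1) by (simp add: h_def)
  ultimately have cm: "c \<le> m" by linarith
  have "confluent_rounding V U S X m g h"
    unfolding confluent_rounding_def
  proof (intro conjI ballI)
    show "supp h \<subseteq> supp g"
    proof
      fix e assume "e \<in> supp h"
      then obtain v w where e: "e = (v, w)" "h v w \<noteq> 0" by (auto simp: supp_def)
      have sup: "g' v w \<noteq> 0" if "h' v w \<noteq> 0" for v w
        using h' that by (auto simp: confluent_rounding_def supp_def)
      have "g v w \<noteq> 0"
        using e(2) u(1) sup[of v w] sup[of v s] uU by (auto simp: h_def up_def g'_def split: if_splits)
      then show "e \<in> supp g" using e by (simp add: supp_def)
    qed
    fix v assume v: "v \<in> U"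
    show "\<exists>w. \<forall>w'. w' \<noteq> w \<longrightarrow> h v w' = 0"
    proof (cases "v = u")
      case False
      then obtain w where w: "\<forall>w'. w' \<noteq> w \<longrightarrow> h' v w' = 0"
        using h' v unfolding confluent_rounding_def by blast
      show ?thesis
        using w False uU h'0[of v u]
        by (intro exI[of _ "if w = s \<and> g v s = 0 then u else w"]) (auto simp: h_def up_def)
    qed (auto simp: h_def)
    show "(\<Sum>w\<in>V. h v w) = (\<Sum>w\<in>V. h w v) + X v" "(\<Sum>w\<in>V. h v w) \<le> m"
    proof -
      have "(\<Sum>w\<in>V. h v w) = (\<Sum>w\<in>V. h w v) + X v \<and> (\<Sum>w\<in>V. h v w) \<le> m"
      proof (cases "v = u")
        case True
        then show ?thesis using outu innu cm by simp
      next
        case False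
        moreover have "v \<noteq> s" using v uU by auto
        moreover have "(\<Sum>w\<in>V. h' v w) = (\<Sum>w\<in>V. h' w v) + X' v \<and> (\<Sum>w\<in>V. h' v w) \<le> m"
          using h' v False unfolding confluent_rounding_def by blast
        ultimately show ?thesis by (simp add: outh innh X'_def)
      qed
      then show "(\<Sum>w\<in>V. h v w) = (\<Sum>w\<in>V. h w v) + X v" "(\<Sum>w\<in>V. h v w) \<le> m" by auto
    qed
  next
    fix r assume r: "r \<in> S"
    show "(\<Sum>v\<in>V. h v r) + X r \<le> m"
    proof (cases "r = s")
      case True
      then show ?thesis using \<open>(\<Sum>v\<in>V. h v s) + X s \<le> m\<close> by simp
    next
      case False
      moreover have "r \<noteq> u" using r uU R(5) by auto
      ultimately show ?thesis using h' r by (auto simp: confluent_rounding_def innh X'_def)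
    qed
  qed
  then show "\<exists>h. confluent_rounding V U S X m g h" by blast
qed

text \<open>Each reduction loses a node or an arc, and none raises the sum of the root potentials.
  The sources merged into a root weigh at most its load, so \<open>base\<close> holds in every
  state. It is used when \<open>U\<close> is empty, but also for a root being given up, which the
  sum no longer covers afterwards. The last case supplies what \<open>routing_reduce_support\<close>
  requires.\<close>

theorem confluent_rounding_exists:
  assumes "routing V q U S X g"
    and "(\<Sum>s\<in>S. potential (load V q X g s)) \<le> P" "(\<Sum>v\<in>U \<union> S. X v) \<le> k"
    and m: "\<And>n::nat. n \<le> k \<Longrightarrow> potential (q * real n) \<le> P \<Longrightarrow> n \<le> m"
  shows "\<exists>h. confluent_rounding V U S X m g h"
  using assms(1-3)
proof (induction "card U + card (supp g)" arbitrary: U S X g rule: less_induct)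
  case less
  note rt = less.prems(1)
  note R = routingD[OF rt]
  have fin: "finite U" "finite S" using R(1,3,4) finite_subset by blast+
  have load_nonneg: "0 \<le> load V q X g s" for s
    unfolding load_def using R(2,6) by (simp add: sum_nonneg)
  have base: "X s \<le> m" if "s \<in> S" for s
  proof (rule m)
    have "X s \<le> (\<Sum>v\<in>U \<union> S. X v)" using that fin by (intro member_le_sum) auto
    then show "X s \<le> k" using less.prems(3) by simp
    have "potential (q * real (X s)) \<le> potential (load V q X g s)"
      unfolding load_def using R(6) by (intro potential_mono) (simp add: sum_nonneg)
    also have "\<dots> \<le> (\<Sum>s\<in>S. potential (load V q X g s))"
      using that fin load_nonneg by (intro member_le_sum potential_nonneg) auto
    finally show "potential (q * real (X s)) \<le> P" using less.prems(2) by simp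
  qed
  consider (empty) "U = {}"
    | (isolated) u where "u \<in> U" "\<And>w. g u w = 0"
    | (contract) u s where "s \<in> S" "g u s \<noteq> 0" "\<And>w. w \<noteq> s \<Longrightarrow> g u w = 0"
    | (shift) u s s' where "s \<in> S" "s' \<in> S" "s' \<noteq> s" "g u s \<noteq> 0" "g u s' \<noteq> 0" "\<And>v. v \<noteq> u \<Longrightarrow> g v s = 0"
    | (cycle) "U \<noteq> {}" "\<And>u. u \<in> U \<Longrightarrow> \<exists>w. g u w \<noteq> 0"
        "\<And>u s. s \<in> S \<Longrightarrow> g u s \<noteq> 0 \<Longrightarrow> \<exists>w. w \<noteq> s \<and> g u w \<noteq> 0"
        "\<And>u s s'. s \<in> S \<Longrightarrow> s' \<in> S \<Longrightarrow> s' \<noteq> s \<Longrightarrow> g u s \<noteq> 0 \<Longrightarrow> g u s' \<noteq> 0 \<Longrightarrow> \<exists>v. v \<noteq> u \<and> g v s \<noteq> 0"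
    by metis
  then show ?case
  proof cases
    case empty
    then have "confluent_rounding V U S X m g (\<lambda>_ _. 0)"
      using base by (auto simp: confluent_rounding_def supp_def)
    then show ?thesis by blast
  next
    case (isolated u)
    have "card (U - {u}) < card U" using isolated fin by (intro psubset_card_mono) auto
    moreover have "(\<Sum>v\<in>(U - {u}) \<union> S. X v) \<le> (\<Sum>v\<in>U \<union> S. X v)" using fin by (intro sum_mono2) auto
    ultimately obtain h where "confluent_rounding V (U - {u}) S X m g h"
      using less.hyps[of "U - {u}" g S X] routing_remove_isolated(1)[OF rt isolated] less.prems by auto
    then show ?thesis using routing_remove_isolated(2)[OF rt isolated] by blast
  next
    case (contract u s)
    note c = routing_contract[OF rt contract]
    have u: "u \<in> U" "u \<notin> S" "s \<notin> U" using R(5,7) contract by auto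
    have "card (U - {u}) < card U" using u fin by (intro psubset_card_mono) auto
    moreover have "(\<Sum>v\<in>(U - {u}) \<union> S. (X(s := X s + X u)) v) = (\<Sum>v\<in>U \<union> S. X v)"
    proof -
      have "U \<union> S = insert u (insert s ((U - {u}) \<union> (S - {s})))" "(U - {u}) \<union> S = insert s ((U - {u}) \<union> (S - {s}))"
        using u contract(1) by auto
      moreover have "(\<Sum>v\<in>(U - {u}) \<union> (S - {s}). (X(s := X s + X u)) v) = (\<Sum>v\<in>(U - {u}) \<union> (S - {s}). X v)"
        using u by (intro sum.cong) auto
      ultimately show ?thesis using fin u contract(1) by auto
    qed
    ultimately show ?thesis
      using less.hyps[OF _ c(1)] c(2,3) less.prems c(4) by (auto simp: add_less_le_mono)
  next
    case (shift u s s')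
    let ?L = "load V q X g"
    define a where "a = g u s"
    define c where "c = g u s'"
    have uV: "u \<in> U" "u \<in> V" "s \<in> V" "s' \<in> V" using R(3,4,7) shift by auto
    have ac: "0 \<le> a" "0 \<le> c" using R(6) by (auto simp: a_def c_def)
    \<comment> \<open>The throughput bound enters here: if \<open>c\<close> exceeds the gap between
      the loads, it makes this gap at most 1 - a, as \<open>potential_absorb\<close>
      demands.\<close>
    have "a + c = (\<Sum>w\<in>{s, s'}. g u w)" using shift(3) by (simp add: a_def c_def)
    also have "\<dots> \<le> (\<Sum>w\<in>V. g u w)" using R(1,6) uV by (intro sum_mono2) auto
    also have "\<dots> \<le> 1" using R(10) uV by blast
    finally have ac1: "a + c \<le> 1" .
    have "(\<Sum>v\<in>V. g v s) = a"
      using sum.remove[OF R(1) uV(2), of "\<lambda>v. g v s"] shift(6) by (simp add: a_def)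
    then have Ls: "?L s = a + q * real (X s)" by (simp add: load_def)
    have rest: "(\<Sum>r\<in>S. k r) = k s + k s' + (\<Sum>r\<in>S - {s, s'}. k r)" for k :: "_ \<Rightarrow> real"
      using fin shift(1-3) by (simp add: sum.remove[of S s] sum.remove[of "S - {s}" s'] Diff_insert2[symmetric] insert_commute)
    show ?thesis
    proof (cases "c \<le> ?L s' - ?L s")
      case True
      define g' where "g' = (\<lambda>v w. g v w + (if v = u then (if w = s then c else if w = s' then - c else 0) else 0))"
      note sh = routing_shift[OF rt shift(1,2) shift(3)[symmetric] shift(4,5), of c, folded g'_def]
      have t: "- g u s \<le> c" "c \<le> g u s'" using ac by (auto simp: a_def c_def)
      have "g' u s' = 0" using shift(3) by (simp add: g'_def c_def)
      then have "supp g' \<subset> supp g" using sh(5)[OF t] shift(5) by (intro supp_psubsetI)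
      then have "card (supp g') < card (supp g)" using R(11) by (rule psubset_card_mono[rotated])
      moreover have "(\<Sum>r\<in>S. potential (load V q X g' r)) \<le> (\<Sum>r\<in>S. potential (?L r))"
        unfolding rest using potential_transfer[OF ac(2) True] sh(2,3)[OF t] sh(4)[OF t]
        by (auto intro!: add_mono sum_mono)
      ultimately obtain h where "confluent_rounding V U S X m g' h"
        using less.hyps[OF _ sh(1)[OF t]] less.prems by auto
      then show ?thesis using confluent_rounding_mono sh(5)[OF t] by blast
    next
      case False
      \<comment> \<open>A shift by \<open>- a\<close>: everything that \<open>u\<close> sends to
        \<open>s\<close> goes to \<open>s'\<close>, and \<open>s\<close>, now without inflow, stops
        being a root.\<close>
      define g' where "g' = (\<lambda>v w. g v w + (if v = u then (if w = s then - a else if w = s' then - (- a) else 0) else 0))"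
      note sh = routing_shift[OF rt shift(1,2) shift(3)[symmetric] shift(4,5), of "- a", folded g'_def]
      have t: "- g u s \<le> - a" "- a \<le> g u s'" using ac by (auto simp: a_def c_def)
      have z: "g' v s = 0" for v using shift(6)[of v] by (auto simp: g'_def a_def)
      then have "supp g' \<subset> supp g" using sh(5)[OF t] shift(4) by (intro supp_psubsetI)
      then have lt: "card (supp g') < card (supp g)" using R(11) by (rule psubset_card_mono[rotated])
      have "a \<le> ?L s" "?L s' - ?L s \<le> 1 - a" "a \<le> 1" using Ls R(2) False ac ac1 by auto
      then have "potential (?L s' + a) \<le> potential (?L s) + potential (?L s')"
        using potential_absorb[of a "?L s" "?L s'"] ac by simp
      moreover have "(\<Sum>r\<in>S - {s}. k r) = k s' + (\<Sum>r\<in>S - {s, s'}. k r)" for k :: "_ \<Rightarrow> real"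
        using fin shift(1-3) by (simp add: sum.remove[of "S - {s}" s'] Diff_insert2[symmetric] insert_commute)
      moreover have "(\<Sum>r\<in>S - {s, s'}. potential (load V q X g' r)) = (\<Sum>r\<in>S - {s, s'}. potential (?L r))"
        using sh(4)[OF t] by (intro sum.cong) auto
      ultimately have "(\<Sum>r\<in>S - {s}. potential (load V q X g' r)) \<le> P"
        using rest[of "\<lambda>r. potential (?L r)"] less.prems(2) sh(3)[OF t] by simp
      moreover have "(\<Sum>v\<in>U \<union> (S - {s}). X v) \<le> (\<Sum>v\<in>U \<union> S. X v)" using fin by (intro sum_mono2) auto
      ultimately obtain h where "confluent_rounding V U (S - {s}) X m g' h"
        using less.hyps[OF _ routing_remove_root(1)[OF sh(1)[OF t] z]] lt less.prems(3) by auto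
      then have "confluent_rounding V U S X m g' h"
        using routing_remove_root(2)[OF sh(1)[OF t] z] base shift(1) by blast
      then show ?thesis using confluent_rounding_mono sh(5)[OF t] by blast
    qed
  next
    case cycle
    obtain g' where g': "routing V q U S X g'" "\<And>s. s \<in> S \<Longrightarrow> load V q X g' s = load V q X g s"
        "supp g' \<subset> supp g"
      by (rule routing_reduce_support[OF rt]; ((rule cycle; assumption) | (rule that; assumption)))
    have "card (supp g') < card (supp g)" using g'(3) R(11) by (intro psubset_card_mono)
    then obtain h where "confluent_rounding V U S X m g' h"
      using less.hyps[OF _ g'(1)] g'(2) less.prems by auto
    then show ?thesis using confluent_rounding_mono g'(3) by blast
  qed
qed

section \<open>Confluent flows in networks\<close>

text \<open>
  The throughputs of the flow sought are the limit of the increasing iteration that pushes the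
  supplies along the arcs in the proportions given by \<open>f\<close>; it is bounded by the throughputs of \<open>f\<close>.
\<close>

lemma exists_exact_subflow:
  fixes f :: "'a \<Rightarrow> 'a \<Rightarrow> real"
  assumes V: "finite V" and f: "\<And>u w. 0 \<le> f u w" and \<sigma>: "\<And>u. 0 \<le> \<sigma> u"
    and U: "\<And>u w. f u w \<noteq> 0 \<Longrightarrow> u \<in> U"
    and le: "\<And>u. u \<in> U \<Longrightarrow> (\<Sum>v\<in>V. f v u) + \<sigma> u \<le> (\<Sum>w\<in>V. f u w)"
  obtains g where "\<And>u w. 0 \<le> g u w" "\<And>u w. g u w \<le> f u w"
    "\<And>u. u \<in> U \<Longrightarrow> (\<Sum>w\<in>V. g u w) = (\<Sum>v\<in>V. g v u) + \<sigma> u"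
proof -
  define F where "F u = (\<Sum>w\<in>V. f u w)" for u
  define p where "p u w = f u w / F u" for u w
  have F0: "0 \<le> F u" for u unfolding F_def using f by (simp add: sum_nonneg)
  have p0: "0 \<le> p u w" for u w unfolding p_def using f F0 by simp
  have pF: "p u w * F u \<le> f u w" for u w using f[of u w] by (simp add: p_def)
  define t where "t = rec_nat (\<lambda>u. 0) (\<lambda>_ r u. if u \<in> U then \<sigma> u + (\<Sum>v\<in>V. p v u * r v) else 0)"
  have t: "t 0 u = 0" "t (Suc i) u = (if u \<in> U then \<sigma> u + (\<Sum>v\<in>V. p v u * t i v) else 0)" for u i
    by (simp_all add: t_def)
  have mono: "t i u \<le> t (Suc i) u \<and> 0 \<le> t i u" for i u
  proof (induction i arbitrary: u)
    case 0
    show ?case using \<sigma> by (simp add: t)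
  next
    case (Suc i)
    have "(\<Sum>v\<in>V. p v u * t i v) \<le> (\<Sum>v\<in>V. p v u * t (Suc i) v)"
      using Suc p0 by (intro sum_mono mult_left_mono) auto
    moreover have "0 \<le> (\<Sum>v\<in>V. p v u * t i v)" using Suc p0 by (intro sum_nonneg mult_nonneg_nonneg) auto
    ultimately show ?case using \<sigma>[of u] by (simp add: t(2)[of "Suc i"] t(2)[of i])
  qed
  \<comment> \<open>By \<open>le\<close>, \<open>F\<close> is a supersolution of the recursion, so
    the iterates started at 0 stay below it.\<close>
  have bound: "t i u \<le> F u" for i u
  proof (induction i arbitrary: u)
    case 0
    show ?case using F0 by (simp add: t)
  next
    case (Suc i)
    show ?case
    proof (cases "u \<in> U")
      case True
      have "p v u * t i v \<le> f v u" for v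
        using mult_left_mono[OF Suc[of v] p0[of v u]] pF[of v u] by linarith
      then have "(\<Sum>v\<in>V. p v u * t i v) \<le> (\<Sum>v\<in>V. f v u)" by (intro sum_mono)
      then show ?thesis using le[OF True] True by (simp add: t F_def)
    qed (use F0 in \<open>simp add: t\<close>)
  qed
  have "\<exists>l. (\<lambda>i. t i u) \<longlonglongrightarrow> l" for u
  proof -
    have "incseq (\<lambda>i. t i u)" using mono by (intro incseq_SucI) auto
    then show ?thesis using bound incseq_convergent[of "\<lambda>i. t i u" "F u"] by metis
  qed
  then obtain L where L: "\<And>u. (\<lambda>i. t i u) \<longlonglongrightarrow> L u" by metis
  have L0: "0 \<le> L u" for u by (rule LIMSEQ_le_const[OF L]) (use mono in auto)
  have LF: "L u \<le> F u" for u by (rule LIMSEQ_le_const2[OF L]) (use bound in auto)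
  have fixpoint: "L u = \<sigma> u + (\<Sum>v\<in>V. p v u * L v)" if "u \<in> U" for u
  proof (rule LIMSEQ_unique)
    show "(\<lambda>i. t (Suc i) u) \<longlonglongrightarrow> L u" using L by (rule LIMSEQ_Suc)
    show "(\<lambda>i. t (Suc i) u) \<longlonglongrightarrow> \<sigma> u + (\<Sum>v\<in>V. p v u * L v)"
      using that by (simp add: t) (intro tendsto_intros L)
  qed
  have out: "(\<Sum>w\<in>V. p u w * L u) = L u" for u
  \<comment> \<open>For F u = 0 the proportions are 0 by the convention for division and do not sum
    to 1, but then L u = 0 as well.\<close>
  proof (cases "F u = 0")
    case True
    then show ?thesis using L0[of u] LF[of u] by simp
  next
    case False
    then have "(\<Sum>w\<in>V. p u w) = 1"
      by (simp add: p_def F_def flip: sum_divide_distrib)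
    then show ?thesis by (simp flip: sum_distrib_right)
  qed
  show ?thesis
  proof (rule that[of "\<lambda>u w. p u w * L u"])
    show "0 \<le> p u w * L u" for u w using p0 L0 by simp
    show "p u w * L u \<le> f u w" for u w
      using mult_left_mono[OF LF[of u] p0[of u w]] pF[of u w] by linarith
    show "(\<Sum>w\<in>V. p u w * L u) = (\<Sum>v\<in>V. p v u * L v) + \<sigma> u" if "u \<in> U" for u
      unfolding out using fixpoint[OF that] by (simp only: add.commute)
  qed
qed

text \<open>The unit is the common supply. As sinks send nothing, their condition in
  \<open>static_flow\<close> becomes automatic.\<close>

definition integral_confluent_flow :: "'v network \<Rightarrow> nat \<Rightarrow> ('v \<Rightarrow> 'v \<Rightarrow> nat) \<Rightarrow> bool" where
  "integral_confluent_flow N m h \<longleftrightarrow>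
     (\<forall>v w. h v w \<noteq> 0 \<longrightarrow> (v, w) \<in> links N) \<and> (\<forall>v\<in>sinks N. \<forall>w. h v w = 0) \<and>
     (\<forall>v\<in>nodes N - sinks N. (\<Sum>w\<in>nodes N. h v w) = (\<Sum>w\<in>nodes N. h w v) + of_bool (v \<in> sources N) \<and>
        (\<Sum>w\<in>nodes N. h v w) \<le> m \<and> (\<exists>w. \<forall>w'. w' \<noteq> w \<longrightarrow> h v w' = 0))"

section \<open>Flows in networks as sums over pairs of nodes\<close>

lemma networkD:
  assumes "network N"
  shows "finite (nodes N)" "finite (links N)" "(u, w) \<in> links N \<Longrightarrow> u \<in> nodes N"
    "(u, w) \<in> links N \<Longrightarrow> w \<in> nodes N" "sinks N \<subseteq> nodes N" "v \<in> nodes N \<Longrightarrow> 0 \<le> node_supply N v"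
proof -
  interpret pair_fin_digraph "graph N" using assms by (simp add: network_def)
  show "finite (nodes N)" "finite (links N)" by auto
  show "u \<in> nodes N" "w \<in> nodes N" if "(u, w) \<in> links N" using in_arcsD1 in_arcsD2 that by auto
qed (use assms in \<open>auto simp: network_def\<close>)

lemma outflow_eq:
  assumes "network N"
  shows "outflow N f v = (\<Sum>w\<in>nodes N. if (v, w) \<in> links N then f (v, w) else 0)"
proof -
  note N = networkD[OF assms]
  have "out_arcs (with_proj (graph N)) v = Pair v ` {w \<in> nodes N. (v, w) \<in> links N}"
    using N(4) by (auto simp: out_arcs_def with_proj_def)
  then have "outflow N f v = (\<Sum>w\<in>{w \<in> nodes N. (v, w) \<in> links N}. f (v, w))"
    unfolding outflow_def by (simp add: sum.reindex inj_on_def)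
  also have "\<dots> = (\<Sum>w\<in>nodes N. if (v, w) \<in> links N then f (v, w) else 0)"
    using N(1) by (simp add: sum.inter_filter)
  finally show ?thesis .
qed

lemma inflow_eq:
  assumes "network N"
  shows "inflow N f v = (\<Sum>w\<in>nodes N. if (w, v) \<in> links N then f (w, v) else 0)"
proof -
  note N = networkD[OF assms]
  have "in_arcs (with_proj (graph N)) v = (\<lambda>w. (w, v)) ` {w \<in> nodes N. (w, v) \<in> links N}"
    using N(3) by (auto simp: in_arcs_def with_proj_def)
  then have "inflow N f v = (\<Sum>w\<in>{w \<in> nodes N. (w, v) \<in> links N}. f (w, v))"
    unfolding inflow_def by (simp add: sum.reindex inj_on_def)
  also have "\<dots> = (\<Sum>w\<in>nodes N. if (w, v) \<in> links N then f (w, v) else 0)"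
    using N(1) by (simp add: sum.inter_filter)
  finally show ?thesis .
qed

lemma congestion_nonneg: "network N \<Longrightarrow> 0 \<le> congestion N f"
  unfolding congestion_def by (intro Max_ge) (auto dest: networkD)

lemma outflow_le_congestion:
  assumes "network N" "uncapacitated N" "v \<in> nodes N - sinks N"
  shows "outflow N f v \<le> congestion N f"
proof -
  have "node_congestion N f v \<le> congestion N f"
    unfolding congestion_def using assms networkD(1) by (intro Max_ge) auto
  then show ?thesis using assms by (simp add: node_congestion_def uncapacitated_def)
qed

text \<open>Division by the congestion gives throughputs of at most 1 and turns the common supply
  into q = d / C \<le> 1. Initial loads are then at most 1, where the potential is linear, so their
  sum is at most \<kappa>.\<close>

theorem integral_confluent_flow_exists:
  assumes net: "network N" and unc: "uncapacitated N"
    and \<kappa>: "card (sources N) = \<kappa>" "2 \<le> \<kappa>" and d: "\<forall>v\<in>sources N. node_supply N v = d"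
    and sat: "satisfiable 1 N f"
  obtains h m where "integral_confluent_flow N m h" "m \<le> \<kappa>"
    "d * real m \<le> congestion N f * (1 + log 2 (real \<kappa>))"
proof -
  note N = networkD[OF net]
  let ?V = "nodes N"
  define C where "C = congestion N f"
  have finsrc: "finite (sources N)" using N(1) by (simp add: sources_def)
  have C0: "0 \<le> C" unfolding C_def by (rule congestion_nonneg[OF net])
  have "sources N \<noteq> {}" using \<kappa> by auto
  then obtain v0 where v0: "v0 \<in> sources N" by blast
  then have "v0 \<in> ?V" "node_supply N v0 \<noteq> 0" by (simp_all add: sources_def)
  then have d0: "0 < d" using bspec[OF d v0] N(6)[of v0] by linarith
  have supply_eq: "node_supply N v = d * of_bool (v \<in> sources N)" if "v \<in> ?V" for v
    using d that by (auto simp: sources_def)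
  have l0: "1 \<le> log 2 (real \<kappa>)" using \<kappa>(2) by simp
  show ?thesis
  \<comment> \<open>If all sources are sinks, the congestion may be 0 and cannot be divided by, but
    the zero flow serves. Otherwise a source outside the sinks emits its own supply, so 0 < d \<le>
    C.\<close>
  proof (cases "sources N \<subseteq> sinks N")
    case True
    then have "integral_confluent_flow N 0 (\<lambda>_ _. 0)" by (auto simp: integral_confluent_flow_def)
    then show ?thesis using that[of 0 "\<lambda>_ _. 0"] C0 l0 by (simp add: C_def)
  next
    case False
    then obtain v1 where v1: "v1 \<in> sources N" "v1 \<in> ?V - sinks N" by (auto simp: sources_def)
    have f0: "0 \<le> f e" if "e \<in> links N" for e using sat that by (auto simp: satisfiable_def static_flow_def)
    have bal: "outflow N f v = inflow N f v + node_supply N v" if "v \<in> ?V - sinks N" for v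
      using sat that unfolding satisfiable_def static_flow_def by (intro antisym) force+
    have outC: "outflow N f v \<le> C" if "v \<in> ?V - sinks N" for v
      unfolding C_def by (rule outflow_le_congestion[OF net unc that])
    have "0 \<le> inflow N f v1" unfolding inflow_eq[OF net] using f0 by (auto intro!: sum_nonneg)
    then have dC: "d \<le> C" using bal[OF v1(2)] outC[OF v1(2)] d v1(1) by simp
    then have C: "0 < C" using d0 by simp
    define q where "q = d / C"
    have q: "0 < q" "q \<le> 1" using d0 C dC by (auto simp: q_def)
    define X :: "'a \<Rightarrow> nat" where "X v = of_bool (v \<in> sources N)" for v
    define S where "S = {v \<in> ?V - sinks N. \<exists>t\<in>sinks N. (v, t) \<in> links N}"
    define U where "U = ?V - sinks N - S"
    have US: "U \<subseteq> ?V" "S \<subseteq> ?V" "U \<inter> S = {}" "U \<union> S = ?V - sinks N" by (auto simp: U_def S_def)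
    have fin: "finite U" "finite S" using US(1,2) N(1) finite_subset by blast+
    \<comment> \<open>Flow that leaves nodes outside \<open>U\<close> is dropped. This lowers
      inflows, so \<open>k\<close> satisfies conservation only as an inequality, which
      \<open>exists_exact_subflow\<close> repairs.\<close>
    define k where "k u w = (if u \<in> U \<and> (u, w) \<in> links N then f (u, w) / C else 0)" for u w
    have k0: "0 \<le> k u w" for u w using f0 C by (simp add: k_def)
    have kout: "(\<Sum>w\<in>?V. k u w) = outflow N f u / C" if "u \<in> U" for u
      unfolding outflow_eq[OF net] sum_divide_distrib using that by (intro sum.cong) (auto simp: k_def)
    have kin: "(\<Sum>v\<in>?V. k v u) \<le> inflow N f u / C" for u
      unfolding inflow_eq[OF net] sum_divide_distrib using f0 C by (intro sum_mono) (auto simp: k_def)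
    have qX: "q * real (X u) = node_supply N u / C" if "u \<in> ?V" for u
      using supply_eq[OF that] by (simp add: q_def X_def)
    have kle: "(\<Sum>v\<in>?V. k v u) + q * real (X u) \<le> outflow N f u / C" if "u \<in> ?V - sinks N" for u
      using kin[of u] qX[of u] that unfolding bal[OF that] by (simp add: add_divide_distrib)
    have kU: "k u w \<noteq> 0 \<Longrightarrow> u \<in> U" for u w by (auto simp: k_def split: if_splits)
    obtain g where g: "\<And>u w. 0 \<le> g u w" "\<And>u w. g u w \<le> k u w"
        "\<And>u. u \<in> U \<Longrightarrow> (\<Sum>w\<in>?V. g u w) = (\<Sum>v\<in>?V. g v u) + q * real (X u)"
    proof (rule exists_exact_subflow[of ?V k "\<lambda>u. q * real (X u)" U])
      show "(\<Sum>v\<in>?V. k v u) + q * real (X u) \<le> (\<Sum>w\<in>?V. k u w)" if "u \<in> U" for u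
        using kle[of u] kout[OF that] that US by auto
    qed (use N(1) k0 q kU in auto)
    have gk: "k u w \<noteq> 0" if "g u w \<noteq> 0" for u w using that g(1)[of u w] g(2)[of u w] by linarith
    have glink: "u \<in> U" "(u, w) \<in> links N" "w \<in> U \<union> S" if "g u w \<noteq> 0" for u w
    proof -
      show u: "u \<in> U" "(u, w) \<in> links N" using gk[OF that] by (auto simp: k_def split: if_splits)
      then show "w \<in> U \<union> S" using N(4) US(4) by (auto simp: U_def S_def)
    qed
    have C1: "outflow N f v / C \<le> 1" if "v \<in> U \<union> S" for v using outC[of v] that US(4) C by simp
    have rt: "routing ?V q U S X g"
      unfolding routing_def
    proof (intro conjI ballI allI impI)
      fix u assume u: "u \<in> U"
      have "(\<Sum>w\<in>?V. g u w) \<le> (\<Sum>w\<in>?V. k u w)" using g(2) by (intro sum_mono)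
      then show "(\<Sum>w\<in>?V. g u w) \<le> 1" using kout[OF u] C1[of u] u by simp
      show "(\<Sum>w\<in>?V. g u w) = (\<Sum>v\<in>?V. g v u) + q * real (X u)" using g(3)[OF u] .
    qed (use N(1) q US g(1) glink in auto)
    have load1: "load ?V q X g s \<le> 1" if "s \<in> S" for s
    proof -
      have "(\<Sum>v\<in>?V. g v s) \<le> (\<Sum>v\<in>?V. k v s)" using g(2) by (intro sum_mono)
      moreover have "s \<in> ?V - sinks N" using that US(4) by blast
      ultimately show ?thesis using kle[of s] C1[of s] that by (auto simp: load_def)
    qed
    \<comment> \<open>Summing \<open>g\<close> by rows and by columns and cancelling the inflows of
      \<open>U\<close> shows that the roots receive exactly the supplies located in
      \<open>U\<close>.\<close>
    have "(\<Sum>u\<in>?V. \<Sum>w\<in>?V. g u w) = (\<Sum>u\<in>U. \<Sum>w\<in>?V. g u w)"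
      using N(1) US(1) glink(1) by (intro sum.mono_neutral_right) (auto intro!: sum.neutral)
    also have "\<dots> = (\<Sum>u\<in>U. \<Sum>v\<in>?V. g v u) + q * real (\<Sum>u\<in>U. X u)"
      using g(3) by (simp add: sum.distrib sum_distrib_left)
    finally have tot1: "(\<Sum>u\<in>?V. \<Sum>w\<in>?V. g u w) = \<dots>" .
    have "(\<Sum>u\<in>?V. \<Sum>w\<in>?V. g u w) = (\<Sum>w\<in>?V. \<Sum>u\<in>?V. g u w)" by (rule sum.swap)
    also have "\<dots> = (\<Sum>w\<in>U \<union> S. \<Sum>u\<in>?V. g u w)"
      using N(1) US glink(3) by (intro sum.mono_neutral_right) (auto intro!: sum.neutral)
    also have "\<dots> = (\<Sum>w\<in>U. \<Sum>u\<in>?V. g u w) + (\<Sum>w\<in>S. \<Sum>u\<in>?V. g u w)"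
      using fin US(3) by (rule sum.union_disjoint)
    finally have tot2: "(\<Sum>w\<in>S. \<Sum>u\<in>?V. g u w) = q * real (\<Sum>u\<in>U. X u)" using tot1 by simp
    have XUS: "(\<Sum>v\<in>U \<union> S. X v) \<le> \<kappa>"
    proof -
      have "(\<Sum>v\<in>U \<union> S. X v) = card ((U \<union> S) \<inter> sources N)"
        using fin by (simp add: X_def of_bool_def sum.If_cases Collect_conj_eq)
      also have "\<dots> \<le> \<kappa>" using \<kappa>(1) finsrc by (metis card_mono inf_le2)
      finally show ?thesis .
    qed
    have "(\<Sum>s\<in>S. potential (load ?V q X g s)) = (\<Sum>s\<in>S. load ?V q X g s)"
    proof (rule sum.cong)
      show "potential (load ?V q X g s) = load ?V q X g s" if "s \<in> S" for s
        using load1[OF that] by (simp add: potential_def)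
    qed simp
    also have "\<dots> = q * real (\<Sum>v\<in>U \<union> S. X v)"
      using tot2 fin US(3) by (simp add: load_def sum.distrib sum_distrib_left sum.union_disjoint distrib_left)
    also have "\<dots> \<le> 1 * real \<kappa>" using q XUS by (intro mult_mono) (simp_all only: of_nat_le_iff of_nat_0_le_iff)
    finally have pot: "(\<Sum>s\<in>S. potential (load ?V q X g s)) \<le> real \<kappa>" by simp
    \<comment> \<open>In units of the supply, q n \<le> 1 + log 2 \<kappa> reads n \<le> C (1 + log
      2 \<kappa>) / d. The minimum with \<kappa> keeps \<open>m\<close> within the range searched
      later.\<close>
    define m where "m = min \<kappa> (nat \<lfloor>C * (1 + log 2 (real \<kappa>)) / d\<rfloor>)"
    have "n \<le> m" if "n \<le> \<kappa>" "potential (q * real n) \<le> real \<kappa>" for n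
    proof -
      have "q * real n \<le> 1 + log 2 (real \<kappa>)" using potential_le_imp_le[OF that(2)] \<kappa>(2) by simp
      then have "real n \<le> C * (1 + log 2 (real \<kappa>)) / d" using C d0 by (simp add: q_def field_simps)
      then show ?thesis using that(1) by (simp add: m_def le_nat_floor)
    qed
    then obtain h where h: "confluent_rounding ?V U S X m g h"
      using confluent_rounding_exists[OF rt pot XUS] by blast
    have hlink: "u \<in> U" "(u, w) \<in> links N" if "h u w \<noteq> 0" for u w
      using h glink that unfolding confluent_rounding_def supp_def by blast+
    have "\<forall>s\<in>S. \<exists>t. t \<in> sinks N \<and> (s, t) \<in> links N" by (auto simp: S_def)
    from bchoice[OF this] obtain t where "\<forall>s\<in>S. t s \<in> sinks N \<and> (s, t s) \<in> links N" ..
    then have t: "t s \<in> sinks N \<and> (s, t s) \<in> links N" if "s \<in> S" for s using that by blast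
    \<comment> \<open>No arc of \<open>h\<close> leaves a root, so each root is free to send its
      whole load to one chosen sink. This changes inflows at sinks only, as \<open>col\<close>
      records.\<close>
    define H where "H v w = (if v \<in> S then (if w = t v then (\<Sum>u\<in>?V. h u v) + X v else 0) else h v w)" for v w
    have col: "(\<Sum>w\<in>?V. H w v) = (\<Sum>w\<in>?V. h w v)" if "v \<in> ?V - sinks N" for v
    proof (rule sum.cong)
      fix w
      show "H w v = h w v"
        using t[of w] that hlink(1)[of w v] US(3) by (auto simp: H_def)
    qed simp
    have "integral_confluent_flow N m H"
      unfolding integral_confluent_flow_def
    proof (intro conjI ballI allI impI)
      show "(v, w) \<in> links N" if "H v w \<noteq> 0" for v w
        using that t hlink(2) by (auto simp: H_def split: if_splits)
      show "H v w = 0" if "v \<in> sinks N" for v w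
        using that hlink(1)[of v w] by (auto simp: H_def S_def U_def)
      fix v assume v: "v \<in> ?V - sinks N"
      have "(\<Sum>w\<in>?V. H v w) = (\<Sum>w\<in>?V. H w v) + of_bool (v \<in> sources N) \<and>
        (\<Sum>w\<in>?V. H v w) \<le> m \<and> (\<exists>w. \<forall>w'. w' \<noteq> w \<longrightarrow> H v w' = 0)"
      proof (cases "v \<in> S")
        case True
        then have "(\<Sum>w\<in>?V. H v w) = (\<Sum>u\<in>?V. h u v) + X v"
          using t[OF True] N(1,5) by (auto simp: H_def)
        moreover have "(\<Sum>u\<in>?V. h u v) + X v \<le> m" using h True unfolding confluent_rounding_def by blast
        moreover have "\<forall>w'. w' \<noteq> t v \<longrightarrow> H v w' = 0" using True by (simp add: H_def)
        ultimately show ?thesis unfolding col[OF v] by (auto simp: X_def)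
      next
        case False
        then have "v \<in> U" using v US(4) by blast
        then have "(\<Sum>w\<in>?V. h v w) = (\<Sum>w\<in>?V. h w v) + X v \<and> (\<Sum>w\<in>?V. h v w) \<le> m \<and>
            (\<exists>w. \<forall>w'. w' \<noteq> w \<longrightarrow> h v w' = 0)"
          using h unfolding confluent_rounding_def by blast
        moreover have "H v = h v" using False by (auto simp: H_def)
        ultimately show ?thesis unfolding col[OF v] by (simp add: X_def)
      qed
      then show "(\<Sum>w\<in>?V. H v w) = (\<Sum>w\<in>?V. H w v) + of_bool (v \<in> sources N)"
        "(\<Sum>w\<in>?V. H v w) \<le> m" "\<exists>w. \<forall>w'. w' \<noteq> w \<longrightarrow> H v w' = 0" by blast+
    qed
    moreover have "d * real m \<le> C * (1 + log 2 (real \<kappa>))"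
    proof -
      have "0 \<le> C * (1 + log 2 (real \<kappa>)) / d" using C d0 l0 by simp
      then have "real m \<le> C * (1 + log 2 (real \<kappa>)) / d" unfolding m_def by linarith
      then show ?thesis using d0 by (simp add: field_simps)
    qed
    ultimately show ?thesis using that[of m H] by (simp add: m_def C_def)
  qed
qed

section \<open>Computable functions\<close>

definition decidable :: "(nat \<Rightarrow> bool) \<Rightarrow> bool" where
  "decidable P \<longleftrightarrow> computable (\<lambda>x. of_bool (P x))"

lemma computable_const: "computable (\<lambda>_. n)"
proof (induction n)
  case (Suc n)
  then show ?case by (rule computable.comp[OF computable.succ])
qed (rule computable.zero)

lemma computable_Suc: "computable f \<Longrightarrow> computable (\<lambda>x. Suc (f x))"
  by (rule computable.comp[OF computable.succ])

lemma computable_fst: "computable f \<Longrightarrow> computable (\<lambda>x. fst (prod_decode (f x)))"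
  by (rule computable.comp[OF computable.proj1])

lemma computable_snd: "computable f \<Longrightarrow> computable (\<lambda>x. snd (prod_decode (f x)))"
  by (rule computable.comp[OF computable.proj2])

text \<open>The whole input \<open>x\<close> is taken as the parameter of the recursion, so that
  start value, step and length may all depend on it.\<close>

lemma computable_rec_nat:
  assumes "computable f" "computable n"
    and "computable (\<lambda>z. g (fst (prod_decode z)) (fst (prod_decode (snd (prod_decode z))))
      (snd (prod_decode (snd (prod_decode z)))))"
  shows "computable (\<lambda>x. rec_nat (f x) (\<lambda>m r. g x m r) (n x))"
  using computable.comp[OF computable.prim_rec[OF assms(1,3)] computable.pair[OF computable.ident assms(2)]]
  by simp

named_theorems computable_intros

lemmas [computable_intros] = computable.ident computable_const computable_Suc
  computable_fst computable_snd computable.pair computable_rec_nat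

section \<open>Arithmetic\<close>

lemma computable_add [computable_intros]:
  assumes "computable f" "computable g"
  shows "computable (\<lambda>x. f x + g x)"
proof -
  have "rec_nat (f x) (\<lambda>_ r. Suc r) n = f x + n" for x n by (induction n) auto
  moreover have "computable (\<lambda>x. rec_nat (f x) (\<lambda>_ r. Suc r) (g x))"
    by (intro computable_intros assms)
  ultimately show ?thesis by simp
qed

lemma computable_diff [computable_intros]:
  assumes "computable f" "computable g"
  shows "computable (\<lambda>x. f x - g x)"
proof -
  \<comment> \<open>A recursion that returns its counter computes the predecessor.\<close>
  have pred: "rec_nat 0 (\<lambda>m _. m) n = n - 1" for n by (cases n) auto
  have "rec_nat (f x) (\<lambda>_ r. rec_nat 0 (\<lambda>m _. m) r) n = f x - n" for x n
    by (induction n) (auto simp: pred)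
  moreover have "computable (\<lambda>x. rec_nat (f x) (\<lambda>_ r. rec_nat 0 (\<lambda>m _. m) r) (g x))"
    by (intro computable_intros assms)
  ultimately show ?thesis by simp
qed

lemma computable_mult [computable_intros]:
  assumes "computable f" "computable g"
  shows "computable (\<lambda>x. f x * g x)"
proof -
  have "rec_nat 0 (\<lambda>_ r. r + f x) n = f x * n" for x n by (induction n) auto
  moreover have "computable (\<lambda>x. rec_nat 0 (\<lambda>_ r. r + f x) (g x))"
    by (intro computable_intros computable.comp[OF assms(1)] assms(2))
  ultimately show ?thesis by simp
qed

lemma computable_power2 [computable_intros]:
  assumes "computable g"
  shows "computable (\<lambda>x. 2 ^ g x)"
proof -
  have "rec_nat 1 (\<lambda>_ r. r + r) n = (2 ^ n :: nat)" for n by (induction n) auto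
  moreover have "computable (\<lambda>x. rec_nat 1 (\<lambda>_ r. r + r) (g x))"
    by (intro computable_intros assms)
  ultimately show ?thesis by simp
qed

lemma computable_sum [computable_intros]:
  assumes "computable n" "computable (\<lambda>z. h (fst (prod_decode z)) (snd (prod_decode z)))"
  shows "computable (\<lambda>x. \<Sum>i<n x. h x i)"
proof -
  have "computable (\<lambda>z. h (fst (prod_decode z)) (fst (prod_decode (snd (prod_decode z)))))"
    using computable.comp[OF assms(2), of
      "\<lambda>z. prod_encode (fst (prod_decode z), fst (prod_decode (snd (prod_decode z))))"]
    by (simp add: computable_intros)
  then have "computable (\<lambda>x. rec_nat 0 (\<lambda>m r. r + h x m) (n x))"
    by (intro computable_intros assms)
  moreover have "rec_nat 0 (\<lambda>m r. r + h x m) k = (\<Sum>i<k. h x i)" for x k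
    by (induction k) (auto simp: add.commute)
  ultimately show ?thesis by simp
qed

section \<open>Decidable predicates\<close>

lemma computable_of_bool: "decidable P \<Longrightarrow> computable (\<lambda>x. of_bool (P x))"
  by (simp add: decidable_def)

lemma computable_if [computable_intros]:
  assumes "decidable P" "computable f" "computable g"
  shows "computable (\<lambda>x. if P x then f x else g x)"
proof -
  have "computable (\<lambda>x. of_bool (P x) * f x + (1 - of_bool (P x)) * g x)"
    using assms by (intro computable_intros computable_of_bool)
  moreover have "of_bool (P x) * f x + (1 - of_bool (P x)) * g x = (if P x then f x else g x)" for x
    by simp
  ultimately show ?thesis by simp
qed

lemma decidable_le [computable_intros]:
  assumes "computable f" "computable g"
  shows "decidable (\<lambda>x. f x \<le> g x)"
proof -
  have "computable (\<lambda>x. 1 - (f x - g x))" by (intro computable_intros assms)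
  moreover have "1 - (f x - g x) = of_bool (f x \<le> g x)" for x by auto
  ultimately show ?thesis by (simp add: decidable_def)
qed

lemma decidable_not [computable_intros]:
  assumes "decidable P"
  shows "decidable (\<lambda>x. \<not> P x)"
proof -
  have eq: "of_bool (\<not> P x) = (1 - of_bool (P x) :: nat)" for x by simp
  show ?thesis
    unfolding decidable_def eq by (intro computable_intros computable_of_bool assms)
qed

lemma decidable_conj [computable_intros]:
  assumes "decidable P" "decidable Q"
  shows "decidable (\<lambda>x. P x \<and> Q x)"
proof -
  have "computable (\<lambda>x. of_bool (P x) * of_bool (Q x))"
    using assms by (intro computable_intros computable_of_bool)
  then show ?thesis by (simp add: decidable_def of_bool_conj)
qed

lemma decidable_disj [computable_intros]:
  assumes "decidable P" "decidable Q"
  shows "decidable (\<lambda>x. P x \<or> Q x)"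
proof -
  have "decidable (\<lambda>x. \<not> (\<not> P x \<and> \<not> Q x))" using assms by (intro computable_intros)
  then show ?thesis by simp
qed

lemma decidable_imp [computable_intros]:
  assumes "decidable P" "decidable Q"
  shows "decidable (\<lambda>x. P x \<longrightarrow> Q x)"
proof -
  have "decidable (\<lambda>x. \<not> P x \<or> Q x)" using assms by (intro computable_intros)
  then show ?thesis by (simp only: imp_conv_disj)
qed

lemma decidable_less [computable_intros]:
  assumes "computable f" "computable g"
  shows "decidable (\<lambda>x. f x < g x)"
proof -
  have "decidable (\<lambda>x. \<not> g x \<le> f x)" using assms by (intro computable_intros)
  then show ?thesis by (simp add: not_le)
qed

lemma decidable_eq [computable_intros]:
  assumes "computable f" "computable g"
  shows "decidable (\<lambda>x. f x = g x)"
proof -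
  have "decidable (\<lambda>x. f x \<le> g x \<and> g x \<le> f x)" using assms by (intro computable_intros)
  then show ?thesis by (simp add: eq_iff)
qed

text \<open>Counting counterexamples turns the bounded quantifier into the vanishing of a
  sum.\<close>

lemma decidable_all_less [computable_intros]:
  assumes "computable n" "decidable (\<lambda>z. P (fst (prod_decode z)) (snd (prod_decode z)))"
  shows "decidable (\<lambda>x. \<forall>i<n x. P x i)"
proof -
  have "computable (\<lambda>z. of_bool (\<not> P (fst (prod_decode z)) (snd (prod_decode z))))"
    using decidable_not[OF assms(2)] by (rule computable_of_bool)
  then have "decidable (\<lambda>x. (\<Sum>i<n x. of_bool (\<not> P x i)) = (0::nat))"
    by (intro computable_intros assms)
  moreover have "((\<Sum>i<n x. of_bool (\<not> P x i)) = (0::nat)) = (\<forall>i<n x. P x i)" for x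
    by auto
  ultimately show ?thesis by simp
qed

lemma decidable_ex_less [computable_intros]:
  assumes "computable n" "decidable (\<lambda>z. P (fst (prod_decode z)) (snd (prod_decode z)))"
  shows "decidable (\<lambda>x. \<exists>i<n x. P x i)"
proof -
  have "decidable (\<lambda>x. \<not> (\<forall>i<n x. \<not> P x i))" by (intro computable_intros assms)
  then show ?thesis by simp
qed

lemma computable_Least:
  assumes "decidable (\<lambda>z. P (fst (prod_decode z)) (snd (prod_decode z)))" "\<And>x. \<exists>n. P x n"
  shows "computable (\<lambda>x. LEAST n. P x n)"
proof -
  let ?f = "\<lambda>z. of_bool (\<not> P (fst (prod_decode z)) (snd (prod_decode z))) :: nat"
  have "computable ?f"
    using decidable_not[OF assms(1)] by (rule computable_of_bool)
  then have "computable (\<lambda>a. LEAST n. ?f (prod_encode (a, n)) = 0)"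
    by (rule computable.minimise) (use assms(2) in simp)
  then show ?thesis by simp
qed

text \<open>Membership means that \<open>g x div 2 ^ f x\<close> is odd. Instead of dividing, one
  searches for \<open>k\<close> such that the quotient is 2 k + 1; it is at most \<open>g x\<close>,
  so the search is bounded.\<close>

lemma decidable_set_decode [computable_intros]:
  assumes "computable f" "computable g"
  shows "decidable (\<lambda>x. f x \<in> set_decode (g x))"
proof -
  have "odd (a div b) \<longleftrightarrow> (\<exists>k<Suc a. b * (2 * k + 1) \<le> a \<and> a < b * (2 * k + 2))" (is "_ \<longleftrightarrow> ?R")
    if "0 < b" for a b :: nat
  proof -
    have iff: "a div b = c \<longleftrightarrow> b * c \<le> a \<and> a < b * Suc c" for c
      using div_nat_eqI[of b c a] that
      by (metis dividend_less_times_div mult_Suc_right times_div_less_eq_dividend mult.commute)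
    have "odd (a div b) \<longleftrightarrow> (\<exists>k. a div b = 2 * k + 1)" by (auto elim: oddE)
    also have "\<dots> \<longleftrightarrow> (\<exists>k<Suc a. a div b = 2 * k + 1)"
    proof -
      have "k < Suc a" if "a div b = 2 * k + 1" for k
        using div_le_dividend[of a b] that by linarith
      then show ?thesis by blast
    qed
    finally show ?thesis by (simp add: iff)
  qed
  then have eq: "(f x \<in> set_decode (g x)) \<longleftrightarrow> (\<exists>k<Suc (g x). 2 ^ f x * (2 * k + 1) \<le> g x \<and> g x < 2 ^ f x * (2 * k + 2))" for x
    by (simp add: set_decode_def)
  show ?thesis
    unfolding eq by (intro computable_intros computable.comp[OF assms(1)] computable.comp[OF assms(2)] assms)
qed

text \<open>The code of a nonempty list is the successor of a pair, hence the subtractions of 1. The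
  empty list has code 0, whose head and tail are again read as 0; so positions past the end give 0,
  the default of \<open>decode_flow\<close>.\<close>

definition list_entry :: "nat \<Rightarrow> nat \<Rightarrow> nat" where
  "list_entry y i = fst (prod_decode (((\<lambda>z. snd (prod_decode (z - 1))) ^^ i) y - 1))"

lemma list_entry_eq: "list_entry y i = (if i < length (list_decode y) then list_decode y ! i else 0)"
proof (induction i arbitrary: y)
  have z: "prod_decode 0 = (0, 0)"
    using prod_encode_inverse[of "(0, 0)"] by (simp add: prod_encode_def)
  {
    case 0
    show ?case by (cases y) (auto simp: list_entry_def z split: prod.splits)
  next
    case (Suc i)
    have "list_entry y (Suc i) = list_entry (snd (prod_decode (y - 1))) i"
      by (simp only: list_entry_def funpow_Suc_right comp_apply)
    then show ?case using Suc by (cases y) (auto simp: z split: prod.splits)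
  }
qed

lemma computable_list_entry [computable_intros]:
  assumes "computable f" "computable g"
  shows "computable (\<lambda>x. list_entry (f x) (g x))"
proof -
  have "rec_nat a (\<lambda>_ r. snd (prod_decode (r - 1))) i = ((\<lambda>z. snd (prod_decode (z - 1))) ^^ i) a" for a i
    by (induction i) auto
  then have eq: "list_entry (f x) (g x) = fst (prod_decode (rec_nat (f x) (\<lambda>_ r. snd (prod_decode (r - 1))) (g x) - 1))" for x
    by (simp add: list_entry_def)
  show ?thesis unfolding eq by (intro computable_intros assms)
qed

lemma prod_encode_mono: "prod_encode (a, b) \<le> prod_encode (c, d)" if "a \<le> c" "b \<le> d"
proof -
  have "(a + b) * Suc (a + b) \<le> (c + d) * Suc (c + d)" using that by (intro mult_mono) auto
  then show ?thesis using that by (auto simp: prod_encode_def triangle_def intro!: add_mono div_le_mono)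
qed

text \<open>Pairing is monotone, so the constant list has the largest code. This makes the search
  space explicitly bounded.\<close>

lemma list_encode_le_replicate:
  "(\<And>a. a \<in> set xs \<Longrightarrow> a \<le> b) \<Longrightarrow> list_encode xs \<le> list_encode (replicate (length xs) b)"
  by (induction xs) (auto intro!: prod_encode_mono)

lemma computable_list_encode_replicate [computable_intros]:
  assumes "computable f" "computable n"
  shows "computable (\<lambda>x. list_encode (replicate (n x) (f x)))"
proof -
  have eq: "list_encode (replicate k b) = rec_nat 0 (\<lambda>_ r. Suc (prod_encode (b, r))) k" for k b
    by (induction k) auto
  show ?thesis unfolding eq by (intro computable_intros assms computable.comp[OF assms(1)])
qed

section \<open>Exhaustive search\<close>

definition code_nodes :: "nat \<Rightarrow> nat set" where
  "code_nodes x = set_decode (fst (prod_decode x))"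

definition code_links :: "nat \<Rightarrow> nat set" where
  "code_links x = set_decode (fst (prod_decode (snd (prod_decode x))))"

definition code_sinks :: "nat \<Rightarrow> nat set" where
  "code_sinks x = set_decode (fst (prod_decode (snd (prod_decode (snd (prod_decode x))))))"

definition code_sources :: "nat \<Rightarrow> nat set" where
  "code_sources x = set_decode (snd (prod_decode (snd (prod_decode (snd (prod_decode x))))))"

definition link_entry :: "nat \<Rightarrow> nat \<Rightarrow> nat \<Rightarrow> nat \<Rightarrow> nat" where
  "link_entry x y v w = (if prod_encode (v, w) \<in> code_links x then list_entry y (prod_encode (v, w)) else 0)"

text \<open>A form of \<open>integral_confluent_flow\<close> in which all sums and quantifiers are
  bounded. The code of a network exceeds each of its nodes, so nothing is lost.\<close>

definition code_flow :: "nat \<Rightarrow> nat \<Rightarrow> nat \<Rightarrow> bool" where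
  "code_flow x m y \<longleftrightarrow>
     (\<forall>v<x. v \<in> code_nodes x \<longrightarrow>
        (v \<in> code_sinks x \<longrightarrow> (\<forall>w<x. link_entry x y v w = 0)) \<and>
        (\<not> v \<in> code_sinks x \<longrightarrow>
           (\<Sum>w<x. link_entry x y v w) = (\<Sum>w<x. link_entry x y w v) + (if v \<in> code_sources x then 1 else 0) \<and>
           (\<Sum>w<x. link_entry x y v w) \<le> m \<and>
           (\<exists>w<x. \<forall>w'<x. \<not> w' = w \<longrightarrow> link_entry x y v w' = 0)))"

text \<open>The code of a network exceeds all its arc codes and is at least its number of nodes,
  hence at least the values of the flow sought; so it serves both as the length of the table and as
  the bound on its entries.\<close>

definition code_bound :: "nat \<Rightarrow> nat" where
  "code_bound x = Suc (list_encode (replicate x x))"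

text \<open>The disjuncts \<open>x < m\<close> and \<open>code_bound x \<le> y\<close> only make the searches total.\<close>

definition least_congestion :: "nat \<Rightarrow> nat" where
  "least_congestion x = (LEAST m. x < m \<or> (\<exists>y<code_bound x. code_flow x m y))"

definition best_flow :: "nat \<Rightarrow> nat" where
  "best_flow x = (LEAST y. code_bound x \<le> y \<or> code_flow x (least_congestion x) y)"

section \<open>Computability of the search\<close>

lemma decidable_code_links [computable_intros]:
  assumes "computable f" "computable g"
  shows "decidable (\<lambda>x. f x \<in> code_links (g x))"
  unfolding code_links_def by (intro computable_intros assms)

lemma decidable_code_nodes [computable_intros]:
  assumes "computable f" "computable g"
  shows "decidable (\<lambda>x. f x \<in> code_nodes (g x))"
  unfolding code_nodes_def by (intro computable_intros assms)

lemma decidable_code_sinks [computable_intros]: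
  assumes "computable f" "computable g"
  shows "decidable (\<lambda>x. f x \<in> code_sinks (g x))"
  unfolding code_sinks_def by (intro computable_intros assms)

lemma decidable_code_sources [computable_intros]:
  assumes "computable f" "computable g"
  shows "decidable (\<lambda>x. f x \<in> code_sources (g x))"
  unfolding code_sources_def by (intro computable_intros assms)

lemma computable_link_entry [computable_intros]:
  assumes "computable x" "computable y" "computable v" "computable w"
  shows "computable (\<lambda>z. link_entry (x z) (y z) (v z) (w z))"
  unfolding link_entry_def by (intro computable_intros assms)

lemma decidable_code_flow [computable_intros]:
  assumes "computable x" "computable m" "computable y"
  shows "decidable (\<lambda>z. code_flow (x z) (m z) (y z))"
  unfolding code_flow_def
  by (intro computable_intros assms computable.comp[OF assms(1)] computable.comp[OF assms(2)] computable.comp[OF assms(3)])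

lemma computable_code_bound [computable_intros]:
  assumes "computable f"
  shows "computable (\<lambda>x. code_bound (f x))"
  unfolding code_bound_def by (intro computable_intros assms)

lemma computable_least_congestion: "computable least_congestion"
  unfolding least_congestion_def
  by (rule computable_Least) (intro computable_intros, blast)

lemma computable_best_flow: "computable best_flow"
  unfolding best_flow_def
  by (rule computable_Least)
    (intro computable_intros computable.comp[OF computable_least_congestion], blast)

text \<open>A candidate within both limits makes each search stop before its escape disjunct
  applies.\<close>

lemma best_flow:
  assumes "code_flow x m y" "m \<le> x" "y < code_bound x"
  shows "code_flow x (least_congestion x) (best_flow x)" "least_congestion x \<le> m"
proof -
  let ?P = "\<lambda>m. x < m \<or> (\<exists>y<code_bound x. code_flow x m y)"
  have "?P m" using assms by blast
  then show le: "least_congestion x \<le> m" unfolding least_congestion_def by (rule Least_le)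
  have "?P (least_congestion x)" unfolding least_congestion_def by (rule LeastI[of ?P m]) fact
  then obtain y' where y': "y' < code_bound x" "code_flow x (least_congestion x) y'" using le assms(2) by auto
  let ?Q = "\<lambda>y. code_bound x \<le> y \<or> code_flow x (least_congestion x) y"
  have "?Q (best_flow x)" unfolding best_flow_def by (rule LeastI[of ?Q y']) (use y' in simp)
  moreover have "best_flow x \<le> y'" unfolding best_flow_def by (rule Least_le) (use y' in simp)
  ultimately show "code_flow x (least_congestion x) (best_flow x)" using y'(1) by auto
qed

section \<open>Correctness of the search on codes of networks\<close>

lemma set_encode_greater: "finite A \<Longrightarrow> i \<in> A \<Longrightarrow> i < set_encode A"
  using member_le_sum[of i A "\<lambda>i. 2 ^ i :: nat"] order.strict_trans2[OF less_exp[of i]] by (simp add: set_encode_def)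

lemma encode_network:
  assumes "network N"
  shows "code_nodes (encode_network N) = nodes N"
    "prod_encode (v, w) \<in> code_links (encode_network N) \<longleftrightarrow> (v, w) \<in> links N"
    "code_sinks (encode_network N) = sinks N" "code_sources (encode_network N) = sources N"
    "v \<in> nodes N \<Longrightarrow> v < encode_network N"
    "(v, w) \<in> links N \<Longrightarrow> prod_encode (v, w) < encode_network N"
proof -
  note N = networkD[OF assms]
  have fin: "finite (sinks N)" "finite (sources N)"
    using N(1,5) by (auto simp: sources_def intro: finite_subset)
  show "code_nodes (encode_network N) = nodes N" "code_sinks (encode_network N) = sinks N"
    "code_sources (encode_network N) = sources N"
    using N(1) fin by (simp_all add: code_nodes_def code_sinks_def code_sources_def encode_network_def)
  show "prod_encode (v, w) \<in> code_links (encode_network N) \<longleftrightarrow> (v, w) \<in> links N"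
    using N(2) by (auto simp: code_links_def encode_network_def)
  show "v < encode_network N" if "v \<in> nodes N"
    using set_encode_greater[OF N(1) that] le_prod_encode_1 unfolding encode_network_def
    by (rule less_le_trans)
  show "prod_encode (v, w) < encode_network N" if "(v, w) \<in> links N"
  proof -
    have "prod_encode (v, w) < set_encode (prod_encode ` links N)"
      using N(2) that by (intro set_encode_greater) auto
    also note le_prod_encode_1
    also note le_prod_encode_2
    finally show ?thesis unfolding encode_network_def .
  qed
qed

lemma sum_link_entry:
  assumes "network N"
  shows "(\<Sum>w<encode_network N. link_entry (encode_network N) y v w) = (\<Sum>w\<in>nodes N. link_entry (encode_network N) y v w)"
    "(\<Sum>w<encode_network N. link_entry (encode_network N) y w v) = (\<Sum>w\<in>nodes N. link_entry (encode_network N) y w v)"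
  using encode_network(2,5)[OF assms] networkD(3,4)[OF assms]
  by (intro sum.mono_neutral_right; auto simp: link_entry_def)+

lemma code_flow_iff:
  assumes net: "network N"
  shows "code_flow (encode_network N) m y \<longleftrightarrow> integral_confluent_flow N m (link_entry (encode_network N) y)"
    (is "_ \<longleftrightarrow> integral_confluent_flow N m ?h")
proof -
  note N = networkD[OF net] and E = encode_network[OF net]
  have link: "(v, w) \<in> links N" if "?h v w \<noteq> 0" for v w
    using that E(2) by (auto simp: link_entry_def split: if_splits)
  have zero: "?h v w = 0" if "\<not> w < encode_network N" for v w
    using link[of v w] N(4) E(5) that by blast
  have all: "(\<forall>w<encode_network N. ?h v w = 0) \<longleftrightarrow> (\<forall>w. ?h v w = 0)" for v
    using zero by blast
  have ex: "(\<exists>w<encode_network N. \<forall>w'<encode_network N. \<not> w' = w \<longrightarrow> ?h v w' = 0) \<longleftrightarrow>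
      (\<exists>w. \<forall>w'. w' \<noteq> w \<longrightarrow> ?h v w' = 0)" if "v < encode_network N" for v
  proof
    assume "\<exists>w<encode_network N. \<forall>w'<encode_network N. \<not> w' = w \<longrightarrow> ?h v w' = 0"
    then show "\<exists>w. \<forall>w'. w' \<noteq> w \<longrightarrow> ?h v w' = 0" using zero by metis
  next
    assume "\<exists>w. \<forall>w'. w' \<noteq> w \<longrightarrow> ?h v w' = 0"
    then obtain w where "\<forall>w'. w' \<noteq> w \<longrightarrow> ?h v w' = 0" by blast
    \<comment> \<open>If \<open>w\<close> is out of range, the entire row vanishes within the range,
      and \<open>v\<close> is an index at hand.\<close>
    then show "\<exists>w<encode_network N. \<forall>w'<encode_network N. \<not> w' = w \<longrightarrow> ?h v w' = 0"
      using that zero by (intro exI[of _ "if w < encode_network N then w else v"]) auto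
  qed
  have ball: "(\<forall>v<encode_network N. v \<in> nodes N \<longrightarrow> P v) \<longleftrightarrow> (\<forall>v\<in>nodes N. P v)" for P
    using E(5) by blast
  have "code_flow (encode_network N) m y \<longleftrightarrow> (\<forall>v\<in>nodes N.
      (v \<in> sinks N \<longrightarrow> (\<forall>w. ?h v w = 0)) \<and>
      (v \<notin> sinks N \<longrightarrow> (\<Sum>w\<in>nodes N. ?h v w) = (\<Sum>w\<in>nodes N. ?h w v) + of_bool (v \<in> sources N) \<and>
        (\<Sum>w\<in>nodes N. ?h v w) \<le> m \<and> (\<exists>w. \<forall>w'. w' \<noteq> w \<longrightarrow> ?h v w' = 0)))"
    unfolding code_flow_def E(1,3,4) sum_link_entry[OF net] all of_bool_def ball
    by (intro ball_cong refl) (simp only: ex[OF E(5)])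
  then show ?thesis
    unfolding integral_confluent_flow_def using link N(5) by blast
qed

text \<open>Tabulating \<open>h\<close> at the numbers below the code of the network reaches every
  arc. Each entry is part of an outflow and thus at most \<open>m\<close>, which keeps the table
  inside the search space.\<close>

lemma code_flow_exists:
  assumes net: "network N" and h: "integral_confluent_flow N m h" "m \<le> encode_network N"
  obtains y where "code_flow (encode_network N) m y" "y < code_bound (encode_network N)"
proof -
  note N = networkD[OF net] and E = encode_network[OF net]
  let ?x = "encode_network N"
  define xs where "xs = map (\<lambda>i. h (fst (prod_decode i)) (snd (prod_decode i))) [0..<?x]"
  have hm: "h v w \<le> m" for v w
  proof (cases "h v w = 0")
    case False
    then have "(v, w) \<in> links N" "v \<notin> sinks N"
      using h(1) unfolding integral_confluent_flow_def by (blast, metis)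
    then have vw: "v \<in> nodes N - sinks N" "w \<in> nodes N" using N(3,4) by blast+
    have "h v w \<le> (\<Sum>w\<in>nodes N. h v w)" using vw N(1) by (intro member_le_sum) auto
    also have "\<dots> \<le> m" using h(1) vw unfolding integral_confluent_flow_def by blast
    finally show ?thesis .
  qed simp
  have "list_encode xs \<le> list_encode (replicate (length xs) ?x)"
    using hm h(2) by (intro list_encode_le_replicate) (auto simp: xs_def intro: le_trans)
  then have "list_encode xs < code_bound ?x" by (simp add: code_bound_def xs_def)
  moreover have "link_entry ?x (list_encode xs) v w = h v w" for v w
    using E(2,6)[of v w] h(1) by (auto simp: link_entry_def list_entry_eq xs_def integral_confluent_flow_def)
  then have "link_entry ?x (list_encode xs) = h" by blast
  then have "code_flow ?x m (list_encode xs)" using h(1) by (simp add: code_flow_iff[OF net])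
  ultimately show ?thesis using that by blast
qed

lemma code_flow_decode:
  assumes net: "network N" and unc: "uncapacitated N" and d: "\<forall>v\<in>sources N. node_supply N v = d" "0 \<le> d"
    and y: "code_flow (encode_network N) m y"
  shows "satisfiable 1 N (decode_flow d y)" "confluent N (decode_flow d y)"
    "congestion N (decode_flow d y) \<le> d * real m"
proof -
  note N = networkD[OF net]
  let ?h = "link_entry (encode_network N) y"
  have h: "integral_confluent_flow N m ?h" using y code_flow_iff[OF net] by blast
  have dec: "decode_flow d y (v, w) = d * real (?h v w)" if "(v, w) \<in> links N" for v w
    using that encode_network(2)[OF net] by (simp add: decode_flow_def link_entry_def list_entry_eq Let_def)
  have h0: "?h v w = 0" if "(v, w) \<notin> links N" for v w
    using that encode_network(2)[OF net] by (simp add: link_entry_def)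
  have out: "outflow N (decode_flow d y) v = d * real (\<Sum>w\<in>nodes N. ?h v w)" for v
    unfolding outflow_eq[OF net] of_nat_sum sum_distrib_left by (intro sum.cong) (auto simp: dec h0)
  have inn: "inflow N (decode_flow d y) v = d * real (\<Sum>w\<in>nodes N. ?h w v)" for v
    unfolding inflow_eq[OF net] of_nat_sum sum_distrib_left by (intro sum.cong) (auto simp: dec h0)
  have supp: "node_supply N v = d * of_bool (v \<in> sources N)" if "v \<in> nodes N" for v
    using d that by (auto simp: sources_def)
  have bal: "outflow N (decode_flow d y) v = inflow N (decode_flow d y) v + node_supply N v"
    and le: "outflow N (decode_flow d y) v \<le> d * real m" if "v \<in> nodes N - sinks N" for v
  proof -
    have "(\<Sum>w\<in>nodes N. ?h v w) = (\<Sum>w\<in>nodes N. ?h w v) + of_bool (v \<in> sources N)" "(\<Sum>w\<in>nodes N. ?h v w) \<le> m"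
      using h that unfolding integral_confluent_flow_def by blast+
    moreover from this(2) have "d * real (\<Sum>w\<in>nodes N. ?h v w) \<le> d * real m"
      using d(2) by (intro mult_left_mono) (simp_all only: of_nat_le_iff)
    ultimately show "outflow N (decode_flow d y) v = inflow N (decode_flow d y) v + node_supply N v"
      "outflow N (decode_flow d y) v \<le> d * real m"
      unfolding out inn using supp[of v] that by (simp_all add: distrib_left)
  qed
  have sink: "outflow N (decode_flow d y) v = 0" if "v \<in> sinks N" for v
    using h that unfolding out integral_confluent_flow_def by simp
  have inn0: "0 \<le> inflow N (decode_flow d y) v" for v
    unfolding inn using d(2) by (intro mult_nonneg_nonneg of_nat_0_le_iff)
  show "satisfiable 1 N (decode_flow d y)"
    unfolding satisfiable_def static_flow_def
  proof (intro conjI ballI)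
    show "0 \<le> decode_flow d y e" if "e \<in> links N" for e using dec d(2) that by (cases e) simp
    show "outflow N (decode_flow d y) v \<le> inflow N (decode_flow d y) v + node_supply N v" if "v \<in> nodes N" for v
      using that bal[of v] sink[of v] inn0[of v] N(6)[of v] by (cases "v \<in> sinks N") auto
    show "inflow N (decode_flow d y) v \<le> outflow N (decode_flow d y) v" if "v \<in> nodes N - sinks N" for v
      using bal[OF that] N(6)[of v] that by simp
    show "1 * node_supply N v \<le> outflow N (decode_flow d y) v - inflow N (decode_flow d y) v"
      if "v \<in> nodes N - sinks N" for v
      using bal[OF that] by simp
  qed
  show "confluent N (decode_flow d y)"
    unfolding confluent_def
  proof
    fix v assume "v \<in> nodes N - sinks N"
    then obtain w where w: "\<forall>w'. w' \<noteq> w \<longrightarrow> ?h v w' = 0"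
      using h unfolding integral_confluent_flow_def by blast
    show "\<exists>e. \<forall>e'\<in>out_arcs (with_proj (graph N)) v. e' \<noteq> e \<longrightarrow> decode_flow d y e' = 0"
      using w dec by (intro exI[of _ "(v, w)"]) (auto simp: out_arcs_def with_proj_def)
  qed
  have "node_congestion N (decode_flow d y) v \<le> d * real m" if "v \<in> nodes N - sinks N" for v
    using le[OF that] that unc by (simp add: node_congestion_def uncapacitated_def)
  then show "congestion N (decode_flow d y) \<le> d * real m"
    unfolding congestion_def using N(1) d(2) by simp
qed

section \<open>The final bound\<close>

lemma card_nodes_le_encode_network: "network N \<Longrightarrow> card (nodes N) \<le> encode_network N"
  using card_mono[of "{..<encode_network N}" "nodes N"] encode_network(5) by auto

text \<open>With L = log 2 \<kappa> \<ge> 1, the constant collects 1 + L \<le> 2 L^3, the inequality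
  C \<le> C^2 / \<delta> for nonzero C, and the change of base that produces the cube of ln
  2.\<close>

lemma polylog_bound:
  assumes \<kappa>: "2 \<le> \<kappa>" and C: "0 < C \<Longrightarrow> \<delta> \<le> C" "0 \<le> C" and \<delta>: "0 < \<delta>"
  shows "C * (1 + log 2 \<kappa>) \<le> 2 / (\<delta> * ln 2 ^ 3) * C\<^sup>2 * ln \<kappa> ^ 3"
proof (cases "C = 0")
  case False
  have L: "1 \<le> log 2 \<kappa>" using \<kappa> by simp
  have "log 2 \<kappa> \<le> log 2 \<kappa> ^ 3" using L power_increasing[of 1 3 "log 2 \<kappa>"] by simp
  then have "1 + log 2 \<kappa> \<le> 2 * log 2 \<kappa> ^ 3" using L by linarith
  then have "C * (1 + log 2 \<kappa>) \<le> C * (2 * log 2 \<kappa> ^ 3)" using C(2) by (rule mult_left_mono)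
  also have "\<dots> \<le> (C * C / \<delta>) * (2 * log 2 \<kappa> ^ 3)"
    using C False \<delta> L by (intro mult_right_mono) (auto simp: field_simps)
  also have "\<dots> = 2 / (\<delta> * ln 2 ^ 3) * C\<^sup>2 * ln \<kappa> ^ 3"
    by (simp add: log_def power_divide power2_eq_square)
  finally show ?thesis .
qed simp

theorem theorem7:
  shows "\<exists>R. randomized_algorithm R \<and>
    (\<exists>c>0. \<forall>\<delta>>0. \<exists>K>0. \<forall>(N :: nat network) (f :: nat \<times> nat \<Rightarrow> real) (d :: real) (\<kappa> :: nat).
       network N \<longrightarrow> uncapacitated N \<longrightarrow>
       card (sources N) = \<kappa> \<longrightarrow> \<kappa> \<ge> 2 \<longrightarrow>
       (\<forall>v\<in>sources N. node_supply N v = d) \<longrightarrow>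
       satisfiable 1 N f \<longrightarrow>
       (0 < congestion N f \<longrightarrow> \<delta> \<le> congestion N f) \<longrightarrow>
       measure_pmf.prob (R (encode_network N))
         {y. satisfiable 1 N (decode_flow d y) \<and>
             confluent N (decode_flow d y) \<and>
             congestion N (decode_flow d y) \<le> K * (congestion N f)\<^sup>2 * (ln (real \<kappa>)) ^ 3}
         \<ge> 1 - real (card (nodes N)) powr (- c))"
proof (intro exI conjI allI impI)
  show "randomized_algorithm (\<lambda>x. return_pmf (best_flow x))"
    unfolding randomized_algorithm_def
  proof (intro exI conjI)
    show "computable (\<lambda>z. best_flow (fst (prod_decode z)))"
      by (rule computable.comp[OF computable_best_flow computable.proj1])
    \<comment> \<open>No coin is tossed: the only outcome is 0, and the output distribution is a
      point mass.\<close>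
    show "computable (\<lambda>_. 0)" by (rule computable.zero)
  qed simp
  \<comment> \<open>Success is certain, so the exponent is arbitrary; it is chosen as 1.\<close>
  show "(0::real) < 1" by simp
  fix \<delta> :: real assume \<delta>: "0 < \<delta>"
  show "0 < 2 / (\<delta> * ln 2 ^ 3)" using \<delta> by simp
  fix N :: "nat network" and f :: "nat \<times> nat \<Rightarrow> real" and d :: real and \<kappa> :: nat
  assume net: "network N" and unc: "uncapacitated N" and \<kappa>: "card (sources N) = \<kappa>" "\<kappa> \<ge> 2"
    and d: "\<forall>v\<in>sources N. node_supply N v = d" and sat: "satisfiable 1 N f"
    and C: "0 < congestion N f \<longrightarrow> \<delta> \<le> congestion N f"
  let ?x = "encode_network N" and ?y = "best_flow (encode_network N)"
  have "sources N \<noteq> {}" using \<kappa> by auto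
  then obtain v where v: "v \<in> sources N" by blast
  then have "v \<in> nodes N" by (simp add: sources_def)
  then have d0: "0 \<le> d" using bspec[OF d v] networkD(6)[OF net, of v] by linarith
  obtain h m where h: "integral_confluent_flow N m h" "m \<le> \<kappa>"
      "d * real m \<le> congestion N f * (1 + log 2 (real \<kappa>))"
    using integral_confluent_flow_exists[OF net unc \<kappa> d sat] .
  have "\<kappa> \<le> card (nodes N)"
    unfolding \<kappa>(1)[symmetric] using networkD(1)[OF net] by (intro card_mono) (auto simp: sources_def)
  then have mx: "m \<le> ?x" using h(2) card_nodes_le_encode_network[OF net] by linarith
  obtain y where "code_flow ?x m y" "y < code_bound ?x" by (rule code_flow_exists[OF net h(1) mx])
  then have y: "code_flow ?x (least_congestion ?x) ?y" "least_congestion ?x \<le> m"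
    using best_flow mx by blast+
  have "d * real (least_congestion ?x) \<le> d * real m" using y(2) d0 by (simp add: mult_left_mono)
  also note h(3)
  also have "congestion N f * (1 + log 2 (real \<kappa>)) \<le> 2 / (\<delta> * ln 2 ^ 3) * (congestion N f)\<^sup>2 * ln (real \<kappa>) ^ 3"
    using \<kappa>(2) C \<delta> congestion_nonneg[OF net] by (intro polylog_bound) auto
  finally have "congestion N (decode_flow d ?y) \<le> 2 / (\<delta> * ln 2 ^ 3) * (congestion N f)\<^sup>2 * ln (real \<kappa>) ^ 3"
    using code_flow_decode(3)[OF net unc d d0 y(1)] by linarith
  then show "1 - real (card (nodes N)) powr (- 1) \<le> measure_pmf.prob (return_pmf ?y)
      {y. satisfiable 1 N (decode_flow d y) \<and> confluent N (decode_flow d y) \<and>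
        congestion N (decode_flow d y) \<le> 2 / (\<delta> * ln 2 ^ 3) * (congestion N f)\<^sup>2 * ln (real \<kappa>) ^ 3}"
    using code_flow_decode(1,2)[OF net unc d d0 y(1)] by simp
qed

end
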